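(* Fix $L\ge 20$. For any pattern $(\mathbf a,\mathbf e)$ there exists $S\subseteq V(\Gamma)$ such that \[p((\mathbf a,\mathbf e)_S)\ge p(\mathbf a,\mathbf e)-150L\sqrt d\] and, for $G$ a random $n$-lift of $H$, \[\mathbb{P}\big((\mathbf a,\mathbf e)_S\text{ can be found in }G\big)\le C\prod_{(i,w)\in S,\,a_{i,w}>0}a_{i,w}^{d/4}\Big(\prod_{(i,w)\in S,\,a_{i,w}>0}\binom{n}{\min(a_{i,w},\lfloor n/2\rfloor)}\Big)^{1-L/10},\] where $C$ is a constant not depending on $n$ or on the pattern.
   Context: $d\ge2$ and $H$ is a $d$-regular graph on $[h]$. A random $n$-lift $G$ of $H$ has vertex set $\{(i,j):i\in[h],j\in[n]\}$, fibres $V_i=\{(i,j):j\in[n]\}$, and for each $ii'\in E(H)$ an independent uniformly random perfect matching between $V_i$ and $V_{i'}$ (no other edges). $D^{>0}=\{2^k/\sqrt{nh}:k\in\mathbb{Z},k\ge0\}$; $\Gamma$ is the graph on $[h]\times D^{>0}$ with $(i,w)\sim_\Gamma(i',w')$ iff $ii'\in E(H)$ and $w/w'\in(d^{-1/2},d^{1/2})$. A pattern is $(\mathbf a,\mathbf e)$: nonnegative integers $a_{i,w}$ with $\sum_wa_{i,w}\le n$ for each $i$, $\sum w^2a_{i,w}\le10$, some $w_0\in D^{>0}$ with $a_{i,w}=0$ unless $w_0\le w\le dw_0$; integers $e_{i,w,i',w'}$ for edges of $\Gamma$ (symmetric) with $0\le e\le\min(a_{i,w},a_{i',w'})$. It can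 be found in $G$ if there are pairwise disjoint $A_{i,w}\subseteq V_i$ with $|A_{i,w}|=a_{i,w}$ and exactly $e_{i,w,i',w'}$ edges of $G$ between $A_{i,w}$ and $A_{i',w'}$ for each edge of $\Gamma$. Potency $p(\mathbf a,\mathbf e)=|\sum_{(i,w)(i',w')\in E(\Gamma)}ww'(e_{i,w,i',w'}-a_{i,w}a_{i',w'}/n)|$. Sub-pattern $(\mathbf a,\mathbf e)_S$: keep $a_{i,w}$ for $(i,w)\in S$ (else $0$) and $e$ on edges with both ends in $S$ (else $0$). *)

theory Defs
  imports "HOL-Probability.Probability" "HOL-Combinatorics.Permutations"
begin

definition regular_graph :: "nat \<Rightarrow> nat \<Rightarrow> (nat \<Rightarrow> nat \<Rightarrow> bool) \<Rightarrow> bool" where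
  "regular_graph d h adjH \<longleftrightarrow>
     (\<forall>i i'. adjH i i' \<longrightarrow> i < h \<and> i' < h \<and> i \<noteq> i') \<and>
     (\<forall>i i'. adjH i i' \<longleftrightarrow> adjH i' i) \<and>
     (\<forall>i<h. card {i'. adjH i i'} = d)"

text \<open>The weight w = 2^k / sqrt(n h) in D^{>0} is encoded by the exponent k :: nat.
Vertices of Gamma are pairs (i,k).\<close>
definition wt :: "nat \<Rightarrow> nat \<Rightarrow> nat \<Rightarrow> real" where
  "wt n h k = 2 ^ k / sqrt (real n * real h)"

definition Gamma_adj :: "nat \<Rightarrow> nat \<Rightarrow> nat \<Rightarrow> (nat \<Rightarrow> nat \<Rightarrow> bool) \<Rightarrow> nat \<times> nat \<Rightarrow> nat \<times> nat \<Rightarrow> bool" where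
  "Gamma_adj d n h adjH x y \<longleftrightarrow>
     adjH (fst x) (fst y) \<and>
     wt n h (snd x) / wt n h (snd y) \<in> {1 / sqrt (real d) <..< sqrt (real d)}"

definition supp :: "(nat \<times> nat \<Rightarrow> nat) \<Rightarrow> (nat \<times> nat) set" where
  "supp a = {x. a x > 0}"

text \<open>Patterns (a, e): a (i,k) = a_{i,w}, e x y = e_{x,y} (only values on edges of Gamma matter).\<close>
definition is_pattern :: "nat \<Rightarrow> nat \<Rightarrow> nat \<Rightarrow> (nat \<Rightarrow> nat \<Rightarrow> bool) \<Rightarrow>
    (nat \<times> nat \<Rightarrow> nat) \<Rightarrow> (nat \<times> nat \<Rightarrow> nat \<times> nat \<Rightarrow> nat) \<Rightarrow> bool" where
  "is_pattern d n h adjH a e \<longleftrightarrow>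
     (\<forall>i k. i \<ge> h \<longrightarrow> a (i, k) = 0) \<and>
     (\<exists>k0. \<forall>i k. a (i, k) \<noteq> 0 \<longrightarrow> wt n h k0 \<le> wt n h k \<and> wt n h k \<le> real d * wt n h k0) \<and>
     (\<forall>i<h. (\<Sum>k\<in>{k. (i, k) \<in> supp a}. a (i, k)) \<le> n) \<and>
     (\<Sum>x\<in>supp a. (wt n h (snd x))\<^sup>2 * real (a x)) \<le> 10 \<and>
     (\<forall>x y. Gamma_adj d n h adjH x y \<longrightarrow> e x y = e y x \<and> e x y \<le> min (a x) (a y))"

text \<open>Potency: sum over the (unordered) edges of Gamma, written as half the sum over
ordered adjacent pairs; only edges with both ends in the support of a can contribute
(for patterns e vanishes on the other edges).\<close>
definition potency :: "nat \<Rightarrow> nat \<Rightarrow> nat \<Rightarrow> (nat \<Rightarrow> nat \<Rightarrow> bool) \<Rightarrow>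
    (nat \<times> nat \<Rightarrow> nat) \<Rightarrow> (nat \<times> nat \<Rightarrow> nat \<times> nat \<Rightarrow> nat) \<Rightarrow> real" where
  "potency d n h adjH a e =
     \<bar>(1/2) * (\<Sum>(x, y)\<in>{(x, y). x \<in> supp a \<and> y \<in> supp a \<and> Gamma_adj d n h adjH x y}.
        wt n h (snd x) * wt n h (snd y) * (real (e x y) - real (a x) * real (a y) / real n))\<bar>"

definition sub_a :: "(nat \<times> nat) set \<Rightarrow> (nat \<times> nat \<Rightarrow> nat) \<Rightarrow> (nat \<times> nat \<Rightarrow> nat)" where
  "sub_a S a = (\<lambda>x. if x \<in> S then a x else 0)"

definition sub_e :: "(nat \<times> nat) set \<Rightarrow> (nat \<times> nat \<Rightarrow> nat \<times> nat \<Rightarrow> nat) \<Rightarrow> (nat \<times> nat \<Rightarrow> nat \<times> nat \<Rightarrow> nat)" where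
  "sub_e S e = (\<lambda>x y. if x \<in> S \<and> y \<in> S then e x y else 0)"

text \<open>Random n-lift: for each edge {i,i'} of H with i < i', a permutation sigma(i,i') of
{0..<n}; vertex (i,j) is joined to (i', sigma(i,i') j). A uniformly random permutation is a
uniformly random perfect matching between V_i and V_i'; choices are independent.\<close>
definition lift_space :: "nat \<Rightarrow> (nat \<Rightarrow> nat \<Rightarrow> bool) \<Rightarrow> ((nat \<times> nat) \<Rightarrow> nat \<Rightarrow> nat) set" where
  "lift_space n adjH = PiE {(i, i'). adjH i i' \<and> i < i'} (\<lambda>_. {f. f permutes {0..<n}})"

definition lift_adj :: "(nat \<Rightarrow> nat \<Rightarrow> bool) \<Rightarrow> ((nat \<times> nat) \<Rightarrow> nat \<Rightarrow> nat) \<Rightarrow> nat \<times> nat \<Rightarrow> nat \<times> nat \<Rightarrow> bool" where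
  "lift_adj adjH \<sigma> u v \<longleftrightarrow> adjH (fst u) (fst v) \<and>
     (if fst u < fst v then \<sigma> (fst u, fst v) (snd u) = snd v
      else \<sigma> (fst v, fst u) (snd v) = snd u)"

text \<open>A_{i,w} \<subseteq> V_i is encoded by A (i,k) \<subseteq> {0..<n} (the second coordinates).\<close>
definition found_in :: "nat \<Rightarrow> nat \<Rightarrow> nat \<Rightarrow> (nat \<Rightarrow> nat \<Rightarrow> bool) \<Rightarrow>
    (nat \<times> nat \<Rightarrow> nat) \<Rightarrow> (nat \<times> nat \<Rightarrow> nat \<times> nat \<Rightarrow> nat) \<Rightarrow> ((nat \<times> nat) \<Rightarrow> nat \<Rightarrow> nat) \<Rightarrow> bool" where
  "found_in d n h adjH a e \<sigma> \<longleftrightarrow>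
     (\<exists>A :: nat \<times> nat \<Rightarrow> nat set.
        (\<forall>x. A x \<subseteq> {0..<n} \<and> card (A x) = a x) \<and>
        (\<forall>i k k'. k \<noteq> k' \<longrightarrow> A (i, k) \<inter> A (i, k') = {}) \<and>
        (\<forall>x y. Gamma_adj d n h adjH x y \<longrightarrow>
           card {(j, j'). j \<in> A x \<and> j' \<in> A y \<and> lift_adj adjH \<sigma> (fst x, j) (fst y, j')} = e x y))"

definition prob_found :: "nat \<Rightarrow> nat \<Rightarrow> nat \<Rightarrow> (nat \<Rightarrow> nat \<Rightarrow> bool) \<Rightarrow>
    (nat \<times> nat \<Rightarrow> nat) \<Rightarrow> (nat \<times> nat \<Rightarrow> nat \<times> nat \<Rightarrow> nat) \<Rightarrow> real" where
  "prob_found d n h adjH a e =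
     measure_pmf.prob (pmf_of_set (lift_space n adjH)) {\<sigma>. found_in d n h adjH a e \<sigma>}"

end

theory Submission
  imports Defs
begin

text \<open>
  Write \<open>\<mu> = a\<^sub>x a\<^sub>y / n\<close>, \<open>I(e, \<mu>) = e ln (e / \<mu>) - e + \<mu>\<close> and \<open>l\<^sub>x = 1 + ln (n / a\<^sub>x)\<close>. Starting from the
  support of the pattern, delete a vertex \<open>x\<close> of \<open>\<Gamma>\<close> as long as its remaining edges have total rate
  \<open>\<Sum>\<^sub>y I(e\<^sub>x\<^sub>y, \<mu>\<^sub>x\<^sub>y)\<close> below \<open>\<kappa> a\<^sub>x l\<^sub>x\<close>, where \<open>\<kappa> = L / 4\<close>.

  A deletion costs little potency. Edges with \<open>e > exp (1 + l\<^sub>x / 4) \<mu>\<close> satisfy \<open>e \<le> 4 I / l\<^sub>x\<close>, and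
  \<open>w\<^sub>y \<le> \<surd>d w\<^sub>x\<close>, so they lose at most \<open>4 \<kappa> \<surd>d w\<^sub>x\<^sup>2 a\<^sub>x\<close>. For the others
  \<open>(e - \<mu>)\<^sup>2 \<le> 2 I max(e, \<mu>)\<close> and Cauchy--Schwarz bound the loss, up to constants, by
  \<open>\<surd>(\<kappa> T) w\<^sub>x \<surd>a\<^sub>x (a\<^sub>x / n)\<^sup>1\<^sup>/\<^sup>4\<close>, where \<open>T\<close> is the mass \<open>\<Sum> w\<^sup>2 a\<close> of the neighbouring fibres; since
  the weights are dyadic, these terms sum geometrically inside each fibre.

  After the deletions the rates of all edges sum to at least \<open>(\<kappa> / 2) \<Sum> a\<^sub>x l\<^sub>x\<close>, and \<open>a\<^sub>x l\<^sub>x\<close> dominates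
  the logarithm of the binomial coefficient. For fixed sets \<open>A\<^sub>x\<close> the edge counts have probability at
  most \<open>exp (- \<Sum> I)\<close> up to a polynomial in the \<open>a\<^sub>x\<close>: colour \<open>V\<^sub>i'\<close> by the sets it contains; pulling the
  colouring back along a uniform permutation gives a uniform colouring with prescribed class sizes,
  which is an independent colouring conditioned on an event of polynomially large probability. The
  polynomial factors are absorbed by the slack between \<open>L / 8\<close> and \<open>L / 10\<close>.
\<close>

section \<open>Stirling quotients\<close>

lemma exp_one_bounds:
  assumes "n \<ge> 1"
  shows "(1 + 1 / real n) ^ n \<le> exp 1" "exp 1 \<le> (1 + 1 / real n) ^ Suc n"
proof -
  show "(1 + 1 / real n) ^ n \<le> exp 1"
    using exp_ge_one_plus_x_over_n_power_n[of n 1] assms by simp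
  have "1 - 1 / real (Suc n) = inverse (1 + 1 / real n)"
    using assms by (simp add: field_simps)
  moreover have "(1 - 1 / real (Suc n)) ^ Suc n \<le> exp (- 1)"
    using exp_ge_one_minus_x_over_n_power_n[of 1 "Suc n"] by simp
  ultimately have "inverse ((1 + 1 / real n) ^ Suc n) \<le> inverse (exp 1)"
    by (simp only: power_inverse exp_minus)
  then show "exp 1 \<le> (1 + 1 / real n) ^ Suc n"
    by (rule inverse_le_imp_le) (intro zero_less_power, simp add: add_pos_nonneg)
qed

definition stirling_quot :: "nat \<Rightarrow> real" where
  "stirling_quot n = fact n * exp (real n) / real n ^ n"

lemma stirling_quot_0 [simp]: "stirling_quot 0 = 1"
  by (simp add: stirling_quot_def)

lemma stirling_quot_Suc:
  assumes "n \<ge> 1"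
  shows "stirling_quot (Suc n) = stirling_quot n * (exp 1 / (1 + 1 / real n) ^ n)"
proof -
  have "1 + 1 / real n = real (Suc n) / real n"
    using assms by (simp add: field_simps)
  moreover have "exp (real (Suc n)) = exp 1 * exp (real n)"
    by (simp flip: exp_add)
  ultimately show ?thesis
    using assms unfolding stirling_quot_def fact_Suc of_nat_mult of_nat_fact
    by (simp add: power_divide del: of_nat_Suc)
qed

lemma stirling_quot_nonneg [simp]: "0 \<le> stirling_quot n"
  by (simp add: stirling_quot_def)

lemma stirling_quot_le_Suc: "stirling_quot n \<le> stirling_quot (Suc n)"
proof (cases "n = 0")
  case True
  then show ?thesis by (simp add: stirling_quot_def)
next
  case False
  then have "1 \<le> exp 1 / (1 + 1 / real n) ^ n"
    using exp_one_bounds(1)[of n] by (simp add: pos_le_divide_eq add_pos_nonneg)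
  then have "stirling_quot n * 1 \<le> stirling_quot n * (exp 1 / (1 + 1 / real n) ^ n)"
    by (intro mult_left_mono) simp_all
  then show ?thesis
    using False by (simp add: stirling_quot_Suc)
qed

lemma stirling_quot_mono: "m \<le> n \<Longrightarrow> stirling_quot m \<le> stirling_quot n"
  by (rule lift_Suc_mono_le[of stirling_quot]) (simp_all add: stirling_quot_le_Suc)

lemma stirling_quot_ge_1: "1 \<le> stirling_quot n"
  using stirling_quot_mono[of 0 n] by simp

lemma stirling_quot_le:
  assumes "n \<ge> 1"
  shows "stirling_quot n \<le> exp 1 * real n"
  using assms
proof (induction n rule: dec_induct)
  case base
  then show ?case by (simp add: stirling_quot_def)
next
  case (step n)
  then have "exp 1 / (1 + 1 / real n) ^ n \<le> 1 + 1 / real n"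
    using exp_one_bounds(2)[of n] by (simp add: pos_divide_le_eq add_pos_nonneg)
  then have "stirling_quot (Suc n) \<le> exp 1 * real n * (1 + 1 / real n)"
    unfolding stirling_quot_Suc[OF step.hyps(1)]
    using step.IH by (intro mult_mono) auto
  also have "\<dots> = exp 1 * real (Suc n)"
    using step.hyps by (simp add: field_simps)
  finally show ?case .
qed

lemma fact_div_power_self: "fact n / real n ^ n = stirling_quot n * exp (- real n)"
  by (simp add: stirling_quot_def exp_minus)

lemma prod_fact_div_power_le:
  assumes "finite Q" "c\<^sub>0 \<in> Q"
  shows "(\<Prod>c\<in>Q. fact (b c) / real (b c) ^ b c)
    \<le> fact (sum b Q) / real (sum b Q) ^ sum b Q * (\<Prod>c\<in>Q - {c\<^sub>0}. stirling_quot (b c))"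
proof -
  have "(\<Prod>c\<in>Q. fact (b c) / real (b c) ^ b c) = (\<Prod>c\<in>Q. stirling_quot (b c)) * exp (- real (sum b Q))"
    using assms(1) by (simp add: fact_div_power_self prod.distrib exp_sum flip: sum_negf)
  also have "(\<Prod>c\<in>Q. stirling_quot (b c)) =
      stirling_quot (b c\<^sub>0) * (\<Prod>c\<in>Q - {c\<^sub>0}. stirling_quot (b c))"
    using assms by (rule prod.remove)
  also have "\<dots> * exp (- real (sum b Q)) \<le>
      stirling_quot (sum b Q) * (\<Prod>c\<in>Q - {c\<^sub>0}. stirling_quot (b c)) * exp (- real (sum b Q))"
    using assms by (intro mult_right_mono stirling_quot_mono member_le_sum prod_nonneg) auto
  also have "\<dots> = fact (sum b Q) / real (sum b Q) ^ sum b Q * (\<Prod>c\<in>Q - {c\<^sub>0}. stirling_quot (b c))"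
    unfolding fact_div_power_self by (simp only: mult_ac)
  finally show ?thesis .
qed

section \<open>The rate function\<close>

definition rate :: "real \<Rightarrow> real \<Rightarrow> real" where
  "rate e \<mu> = e * ln (e / \<mu>) - e + \<mu>"

lemma rate_scale: "\<mu> > 0 \<Longrightarrow> rate e \<mu> = \<mu> * rate (e / \<mu>) 1"
  by (simp add: rate_def field_simps)

lemma rate_1_ge_below:
  fixes x :: real
  assumes "0 \<le> x" "x \<le> 1"
  shows "(x - 1)\<^sup>2 / 2 \<le> rate x 1"
proof (cases "x = 0")
  case False
  define F where "F = (\<lambda>x. rate x 1 - (x - 1)\<^sup>2 / 2)"
  have "F 1 \<le> F x"
  proof (rule DERIV_nonpos_imp_nonincreasing[OF assms(2)])
    fix y assume "x \<le> y" "y \<le> 1"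
    then have y: "y > 0" using False assms by simp
    have "(F has_real_derivative (ln y - (y - 1))) (at y)"
      unfolding F_def rate_def using y by (auto intro!: derivative_eq_intros simp: field_simps)
    moreover have "ln y - (y - 1) \<le> 0" using ln_le_minus_one[OF y] by simp
    ultimately show "\<exists>z. (F has_real_derivative z) (at y) \<and> z \<le> 0" by blast
  qed
  then show ?thesis by (simp add: F_def rate_def)
qed (simp add: rate_def)

lemma rate_1_ge_above:
  fixes x :: real
  assumes "x \<ge> 1"
  shows "(x - 1)\<^sup>2 / (2 * x) \<le> rate x 1"
proof -
  define G where "G = (\<lambda>x::real. ln x - 1 + 1 / x - (1 - 1 / x)\<^sup>2 / 2)"
  have "G 1 \<le> G x"
  proof (rule DERIV_nonneg_imp_nondecreasing[OF assms])
    fix y assume y: "1 \<le> y" "y \<le> x"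
    have "(G has_real_derivative ((1 - 1 / y)\<^sup>2 / y)) (at y)"
      unfolding G_def using y by (auto intro!: derivative_eq_intros simp: power2_eq_square field_simps)
    moreover have "(1 - 1 / y)\<^sup>2 / y \<ge> 0" using y by simp
    ultimately show "\<exists>z. (G has_real_derivative z) (at y) \<and> 0 \<le> z" by blast
  qed
  then have "0 \<le> x * G x" using assms by (simp add: G_def)
  also have "\<dots> = rate x 1 - (x - 1)\<^sup>2 / (2 * x)"
    using assms by (simp add: G_def rate_def power2_eq_square field_simps)
  finally show ?thesis by simp
qed

lemma power2_diff_le_rate:
  assumes "e \<ge> 0" "\<mu> > 0"
  shows "(e - \<mu>)\<^sup>2 \<le> 2 * max e \<mu> * rate e \<mu>"
proof -
  define x where "x = e / \<mu>"
  have x: "x \<ge> 0" "e = \<mu> * x" using assms by (simp_all add: x_def)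
  have "(x - 1)\<^sup>2 \<le> 2 * max x 1 * rate x 1"
  proof (cases "x \<le> 1")
    case True
    then show ?thesis using rate_1_ge_below[OF x(1)] by (simp add: max_def)
  next
    case False
    then show ?thesis using rate_1_ge_above[of x] by (simp add: max_def pos_divide_le_eq mult_ac)
  qed
  then have "\<mu>\<^sup>2 * (x - 1)\<^sup>2 \<le> \<mu>\<^sup>2 * (2 * max x 1 * rate x 1)"
    by (rule mult_left_mono) simp
  also have "\<dots> = 2 * (\<mu> * max x 1) * (\<mu> * rate x 1)"
    by (simp add: power2_eq_square)
  also have "\<mu> * max x 1 = max e \<mu>"
    using assms(2) by (simp add: x(2) max_mult_distrib_left)
  also have "\<mu> * rate x 1 = rate e \<mu>"
    using rate_scale[OF assms(2)] by (simp add: x_def)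
  finally show ?thesis
    by (simp add: x(2) power2_eq_square algebra_simps)
qed

lemma rate_nonneg:
  assumes "e \<ge> 0" "\<mu> > 0"
  shows "rate e \<mu> \<ge> 0"
proof -
  have "0 \<le> (2 * max e \<mu>) * rate e \<mu>"
    using power2_diff_le_rate[OF assms] by (rule order_trans[OF zero_le_power2])
  then show ?thesis
    using assms by (simp add: zero_le_mult_iff max_def split: if_splits)
qed

lemma mult_le_rate:
  assumes "\<mu> > 0" "exp (1 + q) * \<mu> \<le> e"
  shows "q * e \<le> rate e \<mu>"
proof -
  have "0 < exp (1 + q) * \<mu>" using assms(1) by simp
  then have e: "e > 0" using assms(2) by linarith
  have "1 + q \<le> ln (e / \<mu>)"
    using assms e by (subst ln_ge_iff) (auto simp: field_simps)
  then have "e * (1 + q) \<le> e * ln (e / \<mu>)" using e by (intro mult_left_mono) auto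
  then show ?thesis using assms(1) by (simp add: rate_def algebra_simps)
qed

lemma abs_diff_le_rate:
  assumes "e \<ge> 0" "\<mu> > 0" "q > 0"
  shows "\<bar>e - \<mu>\<bar> \<le> rate e \<mu> / q + sqrt (2 * exp (1 + q) * \<mu>) * sqrt (rate e \<mu>)"
proof -
  have rate: "rate e \<mu> \<ge> 0" using assms by (intro rate_nonneg)
  have \<mu>: "\<mu> \<le> exp (1 + q) * \<mu>" using assms by simp
  show ?thesis
  proof (cases "exp (1 + q) * \<mu> \<le> e")
    case True
    then have "e \<le> rate e \<mu> / q"
      using mult_le_rate[OF assms(2) True] assms(3) by (simp add: field_simps)
    moreover have "\<bar>e - \<mu>\<bar> \<le> e" using True \<mu> assms by linarith
    moreover have "0 \<le> sqrt (2 * exp (1 + q) * \<mu>) * sqrt (rate e \<mu>)" using assms rate by simp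
    ultimately show ?thesis by linarith
  next
    case False
    then have "2 * max e \<mu> * rate e \<mu> \<le> 2 * (exp (1 + q) * \<mu>) * rate e \<mu>"
      using \<mu> rate by (intro mult_right_mono mult_left_mono) auto
    then have "(e - \<mu>)\<^sup>2 \<le> 2 * exp (1 + q) * \<mu> * rate e \<mu>"
      using power2_diff_le_rate[OF assms(1,2)] by (simp add: mult_ac)
    then have "\<bar>e - \<mu>\<bar> \<le> sqrt (2 * exp (1 + q) * \<mu>) * sqrt (rate e \<mu>)"
      by (metis real_sqrt_abs real_sqrt_le_iff real_sqrt_mult)
    then show ?thesis using rate assms(3) by (simp add: add_increasing)
  qed
qed

lemma sum_sqrt_mult_sqrt_le:
  fixes f g :: "'i \<Rightarrow> real"
  assumes "\<And>i. i \<in> A \<Longrightarrow> f i \<ge> 0" "\<And>i. i \<in> A \<Longrightarrow> g i \<ge> 0"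
  shows "(\<Sum>i\<in>A. sqrt (f i) * sqrt (g i)) \<le> sqrt (\<Sum>i\<in>A. f i) * sqrt (\<Sum>i\<in>A. g i)"
  using L2_set_mult_ineq[of "\<lambda>i. sqrt (f i)" "\<lambda>i. sqrt (g i)" A] assms by (simp add: L2_set_def)

lemma sum_weighted_abs_diff_le_rate:
  fixes v e \<mu> :: "'y \<Rightarrow> real"
  assumes q: "q > 0"
    and y: "\<And>y. y \<in> Y \<Longrightarrow> 0 \<le> v y \<and> v y \<le> V \<and> 0 \<le> e y \<and> 0 < \<mu> y"
  shows "(\<Sum>y\<in>Y. v y * \<bar>e y - \<mu> y\<bar>) \<le>
    V / q * (\<Sum>y\<in>Y. rate (e y) (\<mu> y)) +
    sqrt (2 * exp (1 + q) * (\<Sum>y\<in>Y. (v y)\<^sup>2 * \<mu> y)) * sqrt (\<Sum>y\<in>Y. rate (e y) (\<mu> y))"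
proof -
  let ?R = "\<lambda>y. rate (e y) (\<mu> y)" and ?f = "\<lambda>y. 2 * exp (1 + q) * ((v y)\<^sup>2 * \<mu> y)"
  have R: "?R y \<ge> 0" if "y \<in> Y" for y using y[OF that] by (intro rate_nonneg) auto
  have "v y * \<bar>e y - \<mu> y\<bar> \<le> V / q * ?R y + sqrt (?f y) * sqrt (?R y)" if Y: "y \<in> Y" for y
  proof -
    have "v y * \<bar>e y - \<mu> y\<bar> \<le> v y * (?R y / q + sqrt (2 * exp (1 + q) * \<mu> y) * sqrt (?R y))"
      using y[OF Y] q by (intro mult_left_mono abs_diff_le_rate) auto
    also have "\<dots> = v y * (?R y / q) + v y * sqrt (2 * exp (1 + q) * \<mu> y) * sqrt (?R y)"
      by (simp add: distrib_left)
    also have "\<dots> \<le> V * (?R y / q) + v y * sqrt (2 * exp (1 + q) * \<mu> y) * sqrt (?R y)"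
      using y[OF Y] q R[OF Y] by (intro add_right_mono mult_right_mono) auto
    also have "v y * sqrt (2 * exp (1 + q) * \<mu> y) = sqrt (?f y)"
      using y[OF Y] by (simp add: real_sqrt_mult)
    finally show ?thesis by simp
  qed
  then have "(\<Sum>y\<in>Y. v y * \<bar>e y - \<mu> y\<bar>) \<le> (\<Sum>y\<in>Y. V / q * ?R y + sqrt (?f y) * sqrt (?R y))"
    by (rule sum_mono)
  also have "\<dots> = V / q * (\<Sum>y\<in>Y. ?R y) + (\<Sum>y\<in>Y. sqrt (?f y) * sqrt (?R y))"
    by (simp only: sum.distrib sum_distrib_left)
  also have "\<dots> \<le> V / q * (\<Sum>y\<in>Y. ?R y) + sqrt (\<Sum>y\<in>Y. ?f y) * sqrt (\<Sum>y\<in>Y. ?R y)"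
    using y R
    by (intro add_left_mono sum_sqrt_mult_sqrt_le mult_nonneg_nonneg) (auto intro: less_imp_le)
  finally show ?thesis by (simp only: sum_distrib_left)
qed

section \<open>Subset entropy\<close>

definition subset_entropy :: "real \<Rightarrow> real \<Rightarrow> real" where
  "subset_entropy n a = a * (1 + ln (n / a))"

lemma subset_entropy_ge:
  assumes "0 < a" "a \<le> n"
  shows "a \<le> subset_entropy n a"
proof -
  have "a * 1 \<le> a * (1 + ln (n / a))"
    using assms by (intro mult_left_mono) auto
  then show ?thesis by (simp add: subset_entropy_def)
qed

lemma subset_entropy_mono:
  assumes "0 < m" "m \<le> a" "a \<le> n"
  shows "subset_entropy n m \<le> subset_entropy n a"
proof -
  have "m * ln (a / m) \<le> m * (a / m - 1)"
    using assms by (intro mult_left_mono ln_le_minus_one) auto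
  then have "m * ln (a / m) \<le> a - m" using assms by (simp add: algebra_simps)
  moreover have "0 \<le> (a - m) * ln (n / a)" using assms by (intro mult_nonneg_nonneg) auto
  moreover have "ln (n / m) = ln (n / a) + ln (a / m)" using assms by (simp add: ln_div)
  ultimately show ?thesis by (simp add: subset_entropy_def algebra_simps)
qed

lemma ln_binomial_le_subset_entropy:
  assumes "1 \<le> m" "m \<le> n"
  shows "ln (real (n choose m)) \<le> subset_entropy n m"
proof -
  have "real m ^ m \<le> fact m * exp (real m)"
    using stirling_quot_ge_1[of m] assms by (simp add: stirling_quot_def)
  then have "real (n choose m) * real m ^ m \<le> real (n choose m) * (fact m * exp (real m))"
    by (intro mult_left_mono) auto
  also have "\<dots> = real ((n choose m) * fact m) * exp (real m)" by simp
  also have "\<dots> \<le> real (n ^ m) * exp (real m)"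
    by (intro mult_right_mono of_nat_mono binomial_fact_pow) auto
  finally have "real (n choose m) \<le> (real n / real m) ^ m * exp (real m)"
    using assms by (simp add: field_simps power_divide)
  then have "ln (real (n choose m)) \<le> ln ((real n / real m) ^ m * exp (real m))"
    using assms by (subst ln_le_cancel_iff) auto
  also have "\<dots> = subset_entropy n m"
    using assms by (simp add: subset_entropy_def ln_mult ln_realpow algebra_simps)
  finally show ?thesis .
qed

lemma ln_binomial_min_le_subset_entropy:
  assumes "1 \<le> a" "a \<le> n"
  shows "ln (real (n choose min a (n div 2))) \<le> subset_entropy n a"
proof (cases "min a (n div 2) = 0")
  case True
  then show ?thesis using assms subset_entropy_ge[of a n] by simp
next
  case False
  then have "ln (real (n choose min a (n div 2))) \<le> subset_entropy n (min a (n div 2))"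
    by (intro ln_binomial_le_subset_entropy) auto
  also have "\<dots> \<le> subset_entropy n a"
    using False assms by (intro subset_entropy_mono) auto
  finally show ?thesis .
qed

lemma exp_ln_mult_le_sqrt:
  fixes u :: real
  assumes "0 < u" "u \<le> 1"
  defines "l \<equiv> 1 - ln u"
  shows "exp (1 + l / 4) * l * u \<le> 16 * sqrt u"
proof -
  define x where "x = - ln u"
  have x: "x \<ge> 0" "u = exp (- x)" "l = 1 + x" using assms by (simp_all add: x_def)
  have "3 / 4 \<le> exp (- (1 / 4) :: real)"
    using exp_ge_add_one_self[of "- (1 / 4) :: real"] by simp
  then have "exp (1 / 4 :: real) \<le> 4 / 3" by (simp add: exp_minus field_simps)
  then have "exp 1 * exp (1 / 4) \<le> 3 * (4 / 3 :: real)"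
    using exp_le by (intro mult_mono) auto
  moreover have "l \<le> 4 * exp (x / 4)"
    using exp_ge_add_one_self[of "x / 4"] x by linarith
  ultimately have "(exp 1 * exp (1 / 4)) * l \<le> 4 * (4 * exp (x / 4))"
    using x by (intro mult_mono) auto
  then have "(exp 1 * exp (1 / 4)) * l * (exp (x / 4) * u) \<le> 4 * (4 * exp (x / 4)) * (exp (x / 4) * u)"
    using x by (intro mult_right_mono) auto
  also have "\<dots> = 16 * exp (- x / 2)"
    unfolding x(2) by (simp flip: exp_add)
  also have "exp (- x / 2) = sqrt u"
    by (rule real_sqrt_unique[symmetric]) (simp_all add: x(2) flip: exp_double)
  finally have "(exp 1 * exp (1 / 4) * exp (x / 4)) * l * u \<le> 16 * sqrt u"
    by (simp add: mult_ac)
  moreover have "exp 1 * exp (1 / 4) * exp (x / 4) = exp (1 + l / 4)"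
    unfolding exp_add[symmetric] by (simp add: x(3) field_simps)
  ultimately show ?thesis by simp
qed

lemma sum_deviation_le_subset_entropy:
  fixes v b e :: "'y \<Rightarrow> real"
  assumes a: "0 < a" "a \<le> n" and \<kappa>: "\<kappa> \<ge> 0" and V: "V \<ge> 0"
    and y: "\<And>y. y \<in> Y \<Longrightarrow> 0 \<le> v y \<and> v y \<le> V \<and> 0 < b y \<and> 0 \<le> e y"
    and T: "(\<Sum>y\<in>Y. (v y)\<^sup>2 * b y) \<le> T"
    and small: "(\<Sum>y\<in>Y. rate (e y) (a * b y / n)) \<le> \<kappa> * subset_entropy n a"
  shows "(\<Sum>y\<in>Y. v y * \<bar>e y - a * b y / n\<bar>) \<le>
    4 * \<kappa> * V * a + sqrt (32 * \<kappa> * T) * (sqrt a * sqrt (sqrt (a / n)))"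
proof -
  define u where "u = a / n"
  define l where "l = 1 - ln u"
  let ?R = "\<Sum>y\<in>Y. rate (e y) (a * b y / n)"
  have u: "0 < u" "u \<le> 1" using a by (simp_all add: u_def)
  have l: "l \<ge> 1" using u by (simp add: l_def)
  have "ln (n / a) = - ln u" using a by (simp add: u_def ln_div)
  then have R_le: "?R \<le> \<kappa> * (a * l)"
    using small by (simp add: subset_entropy_def l_def)
  have R_nonneg: "0 \<le> ?R" using y a by (auto intro!: sum_nonneg rate_nonneg)
  have v_nonneg: "0 \<le> (\<Sum>y\<in>Y. (v y)\<^sup>2 * b y)"
    using y by (intro sum_nonneg mult_nonneg_nonneg) (auto intro: less_imp_le)
  then have T_nonneg: "T \<ge> 0" using T by linarith
  have "(\<Sum>y\<in>Y. v y * \<bar>e y - a * b y / n\<bar>) \<le> V / (l / 4) * ?R +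
      sqrt (2 * exp (1 + l / 4) * (\<Sum>y\<in>Y. (v y)\<^sup>2 * (a * b y / n))) * sqrt ?R"
    using y a l by (intro sum_weighted_abs_diff_le_rate) auto
  also have "(\<Sum>y\<in>Y. (v y)\<^sup>2 * (a * b y / n)) = u * (\<Sum>y\<in>Y. (v y)\<^sup>2 * b y)"
    by (simp add: u_def sum_distrib_left mult_ac)
  also have "V / (l / 4) * ?R + sqrt (2 * exp (1 + l / 4) * (u * (\<Sum>y\<in>Y. (v y)\<^sup>2 * b y))) * sqrt ?R \<le>
      V / (l / 4) * (\<kappa> * (a * l)) + sqrt (2 * exp (1 + l / 4) * (u * T)) * sqrt (\<kappa> * (a * l))"
    using V l u R_nonneg v_nonneg T_nonneg by (intro add_mono mult_mono mult_left_mono real_sqrt_le_mono R_le T) auto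
  also have "sqrt (2 * exp (1 + l / 4) * (u * T)) * sqrt (\<kappa> * (a * l)) =
      sqrt (2 * \<kappa> * T * a * (exp (1 + l / 4) * l * u))"
    by (simp add: mult_ac flip: real_sqrt_mult)
  also have "\<dots> \<le> sqrt (2 * \<kappa> * T * a * (16 * sqrt u))"
    unfolding l_def using exp_ln_mult_le_sqrt[OF u] \<kappa> T_nonneg a
    by (intro real_sqrt_le_mono mult_left_mono) auto
  also have "\<dots> = sqrt (32 * \<kappa> * T) * (sqrt a * sqrt (sqrt u))"
    by (simp add: mult_ac flip: real_sqrt_mult)
  finally show ?thesis using l by (simp add: u_def mult_ac)
qed

lemma power_le_power_mult_exp:
  fixes x :: real
  assumes "0 \<le> x"
  shows "x ^ d \<le> (2 * real d) ^ d * exp (x / 2)"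
proof (cases "d = 0")
  case False
  have "(x / (2 * real d)) ^ d \<le> exp (x / (2 * real d)) ^ d"
    using exp_ge_add_one_self[of "x / (2 * real d)"] assms by (intro power_mono) (linarith, simp)
  also have "\<dots> = exp (x / 2)" using False by (simp flip: exp_of_nat_mult)
  finally show ?thesis
    using False by (simp add: power_divide pos_divide_le_eq mult.commute)
qed (use assms in simp)

lemma binomial_mult_exp_subset_entropy_le:
  assumes a: "1 \<le> a" "a \<le> n" and L: "L \<ge> 20"
  shows "real (n choose a) * (stirling_quot a ^ d * exp (- (L / 8 * subset_entropy n a)))
    \<le> (2 * exp 1 * real d) ^ d * real (n choose min a (n div 2)) powr (1 - L / 10)"
proof -
  define B where "B = real (n choose min a (n div 2))"
  let ?H = "subset_entropy n a"
  have B: "B > 0" "real (n choose a) \<le> B"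
    using a by (simp_all add: B_def min_def binomial_maximum)
  have lnB: "ln B \<le> ?H" unfolding B_def by (rule ln_binomial_min_le_subset_entropy[OF a])
  have "real a \<le> ?H" using a by (intro subset_entropy_ge) auto
  then have "1 / 2 * real a \<le> L / 40 * ?H" using L by (intro mult_mono) auto
  moreover have "L / 10 * ln B \<le> L / 10 * ?H" using lnB L by (intro mult_left_mono) auto
  ultimately have "- (L / 8 * ?H) \<le> - (L / 10) * ln B - real a / 2" by (simp add: field_simps)
  then have "exp (- (L / 8 * ?H)) \<le> exp (- (L / 10) * ln B - real a / 2)" by simp
  also have "\<dots> = B powr (- (L / 10)) * exp (- (real a / 2))"
    using B by (simp add: powr_def flip: exp_add)
  finally have entropy: "exp (- (L / 8 * ?H)) \<le> B powr (- (L / 10)) * exp (- (real a / 2))" .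
  have "stirling_quot a ^ d \<le> (exp 1 * real a) ^ d"
    using stirling_quot_le[OF a(1)] by (intro power_mono) auto
  also have "\<dots> \<le> exp 1 ^ d * ((2 * real d) ^ d * exp (real a / 2))"
    unfolding power_mult_distrib[of "exp 1"] by (intro mult_left_mono power_le_power_mult_exp) auto
  also have "\<dots> = (2 * exp 1 * real d) ^ d * exp (real a / 2)"
    by (simp add: power_mult_distrib)
  finally have polynomial: "stirling_quot a ^ d \<le> (2 * exp 1 * real d) ^ d * exp (real a / 2)" .
  have "real (n choose a) * (stirling_quot a ^ d * exp (- (L / 8 * ?H))) \<le>
      B * ((2 * exp 1 * real d) ^ d * exp (real a / 2) * (B powr (- (L / 10)) * exp (- (real a / 2))))"
    using B entropy polynomial by (intro mult_mono mult_nonneg_nonneg) auto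
  also have "\<dots> = (2 * exp 1 * real d) ^ d * (B * B powr (- (L / 10))) *
      (exp (real a / 2) * exp (- (real a / 2)))"
    by (simp only: mult_ac)
  also have "B * B powr (- (L / 10)) = B powr (1 - L / 10)"
    using B by (simp add: powr_diff powr_minus_divide)
  finally show ?thesis by (simp add: B_def exp_minus)
qed

section \<open>Permutations of coloured sets\<close>

lemma card_inj_PiE_le_fact:
  assumes "finite A" "finite B"
  shows "card {f \<in> A \<rightarrow>\<^sub>E B. inj_on f A} \<le> fact (card B)"
proof (cases "card A \<le> card B")
  case True
  have "card {f \<in> A \<rightarrow>\<^sub>E B. inj_on f A} = (\<Prod>i = 0..<card A. card B - i)"
    using card_inj_on_subset_funcset[OF assms order_refl] by simp
  also have "\<dots> \<le> (\<Prod>i = 0..<card B. card B - i)"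
    using True by (intro dvd_imp_le prod_dvd_prod_subset) (auto simp: fact_prod_rev[symmetric])
  finally show ?thesis by (simp add: fact_prod_rev)
next
  case False
  then have "\<not> inj_on f A" if "f \<in> A \<rightarrow>\<^sub>E B" for f
    using card_inj[of f A B] that assms(2) by (auto simp: PiE_def)
  then have "{f \<in> A \<rightarrow>\<^sub>E B. inj_on f A} = {}" by blast
  then show ?thesis by (simp only: card.empty)
qed

lemma card_permutes_colouring_le:
  assumes "finite A" "finite Q" "s ` A \<subseteq> Q"
  shows "card {p. p permutes A \<and> (\<lambda>x\<in>A. s (p x)) = g} \<le> (\<Prod>c\<in>Q. fact (card {x\<in>A. s x = c}))"
proof -
  let ?P = "{p. p permutes A \<and> (\<lambda>x\<in>A. s (p x)) = g}"
  let ?I = "\<lambda>c. {f \<in> {x\<in>A. g x = c} \<rightarrow>\<^sub>E {x\<in>A. s x = c}. inj_on f {x\<in>A. g x = c}}"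
  let ?split = "\<lambda>p. \<lambda>c\<in>Q. restrict p {x\<in>A. g x = c}"
  have g_Q: "g x \<in> Q" if "p \<in> ?P" "x \<in> A" for p x
    using that assms(3) permutes_in_image[of p A x] by force
  have "inj_on ?split ?P"
  proof (rule inj_onI)
    fix p q assume p: "p \<in> ?P" and q: "q \<in> ?P" and eq: "?split p = ?split q"
    have "p x = q x" if "x \<in> A" for x
      using fun_cong[OF fun_cong[OF eq], of "g x" x] g_Q[OF p that] that by simp
    moreover have "p x = q x" if "x \<notin> A" for x
      using p q that by (simp add: permutes_def)
    ultimately show "p = q" by blast
  qed
  moreover have "?split ` ?P \<subseteq> PiE Q ?I"
  proof (rule image_subsetI)
    fix p assume "p \<in> ?P"
    then have p: "p permutes A" "\<forall>x\<in>A. s (p x) = g x" by auto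
    show "?split p \<in> PiE Q ?I"
      using p permutes_in_image[OF p(1)] permutes_inj_on[OF p(1)] by (auto intro: inj_on_subset)
  qed
  moreover have "finite (?I c)" for c
    using finite_PiE[of "{x\<in>A. g x = c}" "\<lambda>_. {x\<in>A. s x = c}"] assms(1) by simp
  ultimately have "card ?P \<le> card (PiE Q ?I)"
    using assms(2) by (intro card_inj_on_le finite_PiE)
  also have "\<dots> = (\<Prod>c\<in>Q. card (?I c))"
    using assms(2) by (rule card_PiE)
  also have "\<dots> \<le> (\<Prod>c\<in>Q. fact (card {x\<in>A. s x = c}))"
    using assms(1) by (intro prod_mono conjI card_inj_PiE_le_fact) auto
  finally show ?thesis .
qed

lemma prod_if_eq_prod_power_card:
  fixes \<tau> :: "'p \<Rightarrow> 'b::comm_semiring_1"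
  assumes "finite A" "finite E"
  shows "(\<Prod>j\<in>A. if f j \<in> E then \<tau> (f j) else 1) = (\<Prod>p\<in>E. \<tau> p ^ card {j\<in>A. f j = p})"
proof -
  have "(\<Prod>j\<in>A. if f j \<in> E then \<tau> (f j) else 1) = (\<Prod>j\<in>{j\<in>A. f j \<in> E}. \<tau> (f j))"
    using assms(1) by (rule prod.inter_filter[symmetric])
  also have "\<dots> = (\<Prod>p\<in>E. \<Prod>j\<in>{j\<in>{j\<in>A. f j \<in> E}. f j = p}. \<tau> (f j))"
    using assms by (intro prod.group[symmetric]) auto
  also have "\<dots> = (\<Prod>p\<in>E. \<tau> p ^ card {j\<in>A. f j = p})"
  proof (intro prod.cong refl)
    fix p assume "p \<in> E"
    then have "{j\<in>{j\<in>A. f j \<in> E}. f j = p} = {j\<in>A. f j = p}" by auto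
    then show "(\<Prod>j\<in>{j\<in>{j\<in>A. f j \<in> E}. f j = p}. \<tau> (f j)) = \<tau> p ^ card {j\<in>A. f j = p}"
      by simp
  qed
  finally show ?thesis .
qed

lemma prod_permutes_colour:
  fixes f :: "'c \<Rightarrow> 'b::comm_semiring_1"
  assumes "finite A" "finite Q" "s ` A \<subseteq> Q" "\<sigma> permutes A"
  shows "(\<Prod>j\<in>A. f (s (\<sigma> j))) = (\<Prod>c\<in>Q. f c ^ card {k\<in>A. s k = c})"
proof -
  have "(\<Prod>j\<in>A. f (s (\<sigma> j))) = (\<Prod>k\<in>A. f (s k))"
    using permutes_imp_bij[OF assms(4)] by (rule prod.reindex_bij_betw)
  also have "\<dots> = (\<Prod>k\<in>A. if s k \<in> Q then f (s k) else 1)"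
    using assms(3) by (intro prod.cong) auto
  finally show ?thesis
    by (simp only: prod_if_eq_prod_power_card[OF assms(1,2)])
qed

text \<open>
  The sum over permutations becomes a sum over colourings, which factorises once the constraint on
  their class sizes is dropped.
\<close>
lemma sum_permutes_prod_colour_le:
  fixes t :: "'a \<Rightarrow> 'c \<Rightarrow> real"
  assumes A: "finite A" and Q: "finite Q" "s ` A \<subseteq> Q" and t: "\<And>j c. t j c \<ge> 0"
  defines "b \<equiv> \<lambda>c. card {k\<in>A. s k = c}"
  shows "(\<Sum>\<sigma> | \<sigma> permutes A. \<Prod>j\<in>A. t j (s (\<sigma> j)))
     \<le> (\<Prod>c\<in>Q. fact (b c) / real (b c) ^ b c) * (\<Prod>j\<in>A. \<Sum>c\<in>Q. real (b c) * t j c)"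
proof -
  let ?P = "{\<sigma>. \<sigma> permutes A}"
  define col where "col \<sigma> = (\<lambda>j\<in>A. s (\<sigma> j))" for \<sigma>
  define F where "F g = (\<Prod>j\<in>A. t j (g j))" for g
  define K where "K = (\<Prod>c\<in>Q. fact (b c) :: real)"
  define M where "M = (\<Prod>c\<in>Q. real (b c) ^ b c)"
  have M: "M > 0"
    unfolding M_def
  proof (intro prod_pos)
    show "real (b c) ^ b c > 0" for c by (cases "b c = 0") auto
  qed
  have K: "K \<ge> 0" unfolding K_def by (intro prod_nonneg) simp
  have F: "F g \<ge> 0" for g unfolding F_def by (intro prod_nonneg) (auto simp: t)
  have fibre: "real (card {\<sigma>\<in>?P. col \<sigma> = g}) \<le> K" for g
    using of_nat_mono[OF card_permutes_colouring_le[OF A Q, of g], where 'a = real]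
    by (simp add: col_def K_def b_def)
  have weight: "(\<Prod>j\<in>A. real (b (col \<sigma> j))) = M" if "\<sigma> permutes A" for \<sigma>
    unfolding M_def b_def prod_permutes_colour[OF A Q that, symmetric]
    by (intro prod.cong) (auto simp: col_def)
  have "(\<Sum>\<sigma>\<in>?P. \<Prod>j\<in>A. t j (s (\<sigma> j))) = (\<Sum>\<sigma>\<in>?P. F (col \<sigma>))"
    by (intro sum.cong) (auto simp: F_def col_def)
  also have "\<dots> = (\<Sum>g\<in>col ` ?P. real (card {\<sigma>\<in>?P. col \<sigma> = g}) * F g)"
    using A by (subst sum.image_gen[of _ _ col]) (auto simp: finite_permutations intro!: sum.cong)
  also have "\<dots> \<le> (\<Sum>g\<in>col ` ?P. K * F g)"
    by (intro sum_mono mult_right_mono fibre F)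
  also have "\<dots> = K / M * (\<Sum>g\<in>col ` ?P. \<Prod>j\<in>A. real (b (g j)) * t j (g j))"
    using M by (auto simp: sum_distrib_left prod.distrib F_def weight intro!: sum.cong)
  also have "\<dots> \<le> K / M * (\<Sum>g\<in>A \<rightarrow>\<^sub>E Q. \<Prod>j\<in>A. real (b (g j)) * t j (g j))"
  proof (intro mult_left_mono sum_mono2)
    show "col ` ?P \<subseteq> A \<rightarrow>\<^sub>E Q"
      using Q permutes_in_image[of _ A] by (auto simp: col_def image_subset_iff)
  qed (use A Q M K t in \<open>auto intro!: finite_PiE prod_nonneg\<close>)
  also have "\<dots> = K / M * (\<Prod>j\<in>A. \<Sum>c\<in>Q. real (b c) * t j c)"
    using A Q by (subst prod_sum_PiE) auto
  finally show ?thesis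
    by (simp only: K_def M_def prod_dividef)
qed

lemma sum_tilted_row_le:
  fixes b :: "'y \<Rightarrow> nat" and \<tau> :: "'x \<times> 'y \<Rightarrow> real"
  assumes "finite Q" "finite E" "snd ` E \<subseteq> Q" and n: "sum b Q > 0"
  shows "(\<Sum>y\<in>Q. real (b y) * (if (x, y) \<in> E then \<tau> (x, y) else 1)) \<le>
    real (sum b Q) * exp (\<Sum>p\<in>{p\<in>E. x = fst p}. real (b (snd p)) * (\<tau> p - 1) / real (sum b Q))"
    (is "?lhs \<le> real ?n * exp ?z")
proof -
  have "?lhs = (\<Sum>y\<in>Q. real (b y) + (if (x, y) \<in> E then real (b y) * (\<tau> (x, y) - 1) else 0))"
    by (intro sum.cong) (auto simp: algebra_simps)
  also have "\<dots> = real ?n + (\<Sum>y\<in>{y\<in>Q. (x, y) \<in> E}. real (b y) * (\<tau> (x, y) - 1))"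
    using assms(1) by (simp add: sum.distrib sum.inter_filter)
  also have "(\<Sum>y\<in>{y\<in>Q. (x, y) \<in> E}. real (b y) * (\<tau> (x, y) - 1)) =
      (\<Sum>p\<in>{p\<in>E. x = fst p}. real (b (snd p)) * (\<tau> p - 1))"
    using assms(3) by (intro sum.reindex_bij_witness[of _ snd "Pair x"]) auto
  also have "\<dots> = real ?n * ?z"
    using n by (simp flip: sum_divide_distrib del: of_nat_sum)
  also have "real ?n + real ?n * ?z = real ?n * (1 + ?z)"
    by (simp add: distrib_left)
  also have "\<dots> \<le> real ?n * exp ?z"
    by (intro mult_left_mono exp_ge_add_one_self of_nat_0_le_iff)
  finally show ?thesis .
qed

lemma prod_tilted_rows_le:
  fixes r :: "'a \<Rightarrow> 'x" and b :: "'y \<Rightarrow> nat" and \<tau> :: "'x \<times> 'y \<Rightarrow> real"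
  assumes A: "finite A" "A \<noteq> {}" and Q: "finite Q" "sum b Q = card A" and E: "finite E" "snd ` E \<subseteq> Q"
    and \<tau>: "\<And>p. \<tau> p \<ge> 0"
  shows "(\<Prod>j\<in>A. \<Sum>y\<in>Q. real (b y) * (if (r j, y) \<in> E then \<tau> (r j, y) else 1)) \<le>
    real (card A) ^ card A *
    exp (\<Sum>p\<in>E. real (card {j\<in>A. r j = fst p}) * real (b (snd p)) / real (card A) * (\<tau> p - 1))"
proof -
  let ?n = "card A"
  let ?F = "\<lambda>p. real (b (snd p)) * (\<tau> p - 1) / real ?n"
  have "(\<Prod>j\<in>A. \<Sum>y\<in>Q. real (b y) * (if (r j, y) \<in> E then \<tau> (r j, y) else 1)) \<le>
      (\<Prod>j\<in>A. real ?n * exp (\<Sum>p\<in>{p\<in>E. r j = fst p}. ?F p))"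
    using sum_tilted_row_le[OF Q(1) E, of b _ \<tau>] A Q(2) \<tau>
    by (intro prod_mono conjI sum_nonneg) (auto simp: card_gt_0_iff)
  also have "\<dots> = real ?n ^ ?n * exp (\<Sum>j\<in>A. \<Sum>p\<in>{p\<in>E. r j = fst p}. ?F p)"
    using A by (simp add: prod.distrib exp_sum)
  also have "(\<Sum>j\<in>A. \<Sum>p\<in>{p\<in>E. r j = fst p}. ?F p) = (\<Sum>p\<in>E. \<Sum>j\<in>{j\<in>A. r j = fst p}. ?F p)"
    using A(1) E(1) by (rule sum.swap_restrict)
  also have "\<dots> = (\<Sum>p\<in>E. real (card {j\<in>A. r j = fst p}) * real (b (snd p)) / real ?n * (\<tau> p - 1))"
    by (intro sum.cong) simp_all
  finally show ?thesis .
qed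

text \<open>Exponential Markov inequality with the weight \<open>\<tau> p\<close> for each \<open>j\<close> whose colour pair is \<open>p\<close>.\<close>
lemma card_permutes_pair_counts_tilted_le:
  fixes r :: "'a \<Rightarrow> 'x" and s :: "'a \<Rightarrow> 'y" and \<tau> :: "'x \<times> 'y \<Rightarrow> real"
  assumes A: "finite A" "A \<noteq> {}" and Q: "finite Q" "s ` A \<subseteq> Q" "c\<^sub>0 \<in> Q"
    and E: "finite E" "snd ` E \<subseteq> Q" and \<tau>: "\<And>p. \<tau> p \<ge> 0"
  defines "b \<equiv> \<lambda>y. card {k\<in>A. s k = y}"
  shows "real (card {\<sigma>. \<sigma> permutes A \<and> (\<forall>p\<in>E. card {j\<in>A. (r j, s (\<sigma> j)) = p} = e p)}) *
      (\<Prod>p\<in>E. \<tau> p ^ e p)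
    \<le> fact (card A) * (\<Prod>y\<in>Q - {c\<^sub>0}. stirling_quot (b y)) *
      exp (\<Sum>p\<in>E. real (card {j\<in>A. r j = fst p}) * real (b (snd p)) / real (card A) * (\<tau> p - 1))"
    (is "real (card ?G) * ?W \<le> _ * exp ?Z")
proof -
  let ?n = "card A"
  define t where "t j y = (if (r j, y) \<in> E then \<tau> (r j, y) else 1)" for j y
  have t: "t j y \<ge> 0" for j y by (simp add: t_def \<tau>)
  have n: "real ?n > 0" using A by (simp add: card_gt_0_iff)
  have b: "sum b Q = ?n"
    unfolding b_def using sum.group[of A Q s "\<lambda>_. 1::nat"] A Q by simp
  have "(\<Prod>j\<in>A. t j (s (\<sigma> j))) = ?W" if "\<sigma> \<in> ?G" for \<sigma>
    unfolding t_def prod_if_eq_prod_power_card[OF A(1) E(1), of "\<lambda>j. (r j, s (\<sigma> j))"]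
    using that by (intro prod.cong) auto
  then have "real (card ?G) * ?W = (\<Sum>\<sigma>\<in>?G. \<Prod>j\<in>A. t j (s (\<sigma> j)))"
    by simp
  also have "\<dots> \<le> (\<Sum>\<sigma> | \<sigma> permutes A. \<Prod>j\<in>A. t j (s (\<sigma> j)))"
    using A(1) by (intro sum_mono2 prod_nonneg t finite_permutations) auto
  also have "\<dots> \<le> (\<Prod>y\<in>Q. fact (b y) / real (b y) ^ b y) * (\<Prod>j\<in>A. \<Sum>y\<in>Q. real (b y) * t j y)"
    unfolding b_def by (rule sum_permutes_prod_colour_le[OF A(1) Q(1,2) t])
  also have "\<dots> \<le> (fact ?n / real ?n ^ ?n * (\<Prod>y\<in>Q - {c\<^sub>0}. stirling_quot (b y))) *
      (real ?n ^ ?n * exp ?Z)"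
  proof (rule mult_mono)
    show "(\<Prod>y\<in>Q. fact (b y) / real (b y) ^ b y) \<le>
        fact ?n / real ?n ^ ?n * (\<Prod>y\<in>Q - {c\<^sub>0}. stirling_quot (b y))"
      using prod_fact_div_power_le[OF Q(1,3), of b] by (simp only: b)
    show "(\<Prod>j\<in>A. \<Sum>y\<in>Q. real (b y) * t j y) \<le> real ?n ^ ?n * exp ?Z"
      unfolding t_def by (rule prod_tilted_rows_le[OF A Q(1) b E \<tau>])
  qed (auto intro!: divide_nonneg_nonneg mult_nonneg_nonneg prod_nonneg sum_nonneg t)
  also have "\<dots> = fact ?n * (\<Prod>y\<in>Q - {c\<^sub>0}. stirling_quot (b y)) * exp ?Z"
    using n by simp
  finally show ?thesis .
qed

text \<open>
  The optimal tilt is \<open>\<tau> = e / \<mu>\<close>. It also covers \<open>e = 0\<close>, because \<open>0 ^ 0 = 1\<close> on one side and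
  \<open>0 * ln 0 = 0\<close> on the other.
\<close>
lemma card_permutes_pair_counts_le:
  fixes r :: "'a \<Rightarrow> 'x" and s :: "'a \<Rightarrow> 'y"
  assumes A: "finite A" "A \<noteq> {}" and Q: "finite Q" "s ` A \<subseteq> Q" "c\<^sub>0 \<in> Q"
    and E: "finite E" "\<And>p. p \<in> E \<Longrightarrow> fst p \<in> r ` A \<and> snd p \<in> s ` A"
  defines "a \<equiv> \<lambda>x. card {j\<in>A. r j = x}" and "b \<equiv> \<lambda>y. card {k\<in>A. s k = y}"
  shows "real (card {\<sigma>. \<sigma> permutes A \<and> (\<forall>p\<in>E. card {j\<in>A. (r j, s (\<sigma> j)) = p} = e p)})
    \<le> fact (card A) * (\<Prod>y\<in>Q - {c\<^sub>0}. stirling_quot (b y)) *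
      exp (- (\<Sum>p\<in>E. rate (real (e p)) (real (a (fst p)) * real (b (snd p)) / real (card A))))"
    (is "real (card ?G) \<le> ?K * _")
proof -
  define \<mu> where "\<mu> p = real (a (fst p)) * real (b (snd p)) / real (card A)" for p
  define T where "T = (\<Sum>p\<in>E. real (e p) * ln (real (e p) / \<mu> p))"
  have \<mu>: "\<mu> p > 0" if p: "p \<in> E" for p
  proof -
    obtain j k where "j \<in> A" "fst p = r j" "k \<in> A" "snd p = s k" using E(2)[OF p] by auto
    then have "a (fst p) > 0" "b (snd p) > 0"
      using A(1) by (auto simp: a_def b_def card_gt_0_iff)
    then show ?thesis using A by (simp add: \<mu>_def card_gt_0_iff)
  qed
  have "(real (e p) / \<mu> p) ^ e p = exp (real (e p) * ln (real (e p) / \<mu> p))" if "p \<in> E" for p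
    using \<mu>[OF that] by (cases "e p = 0") (simp_all add: exp_of_nat_mult)
  then have weight: "(\<Prod>p\<in>E. (real (e p) / \<mu> p) ^ e p) = exp T"
    unfolding T_def using E(1) by (simp add: exp_sum)
  have "snd ` E \<subseteq> Q" using E(2) Q(2) by force
  then have "real (card ?G) * (\<Prod>p\<in>E. (real (e p) / \<mu> p) ^ e p) \<le>
      ?K * exp (\<Sum>p\<in>E. \<mu> p * (real (e p) / \<mu> p - 1))"
    unfolding \<mu>_def a_def b_def
    by (rule card_permutes_pair_counts_tilted_le[OF A Q E(1)]) simp
  also have "(\<Sum>p\<in>E. \<mu> p * (real (e p) / \<mu> p - 1)) = (\<Sum>p\<in>E. real (e p) - \<mu> p)"
    by (intro sum.cong) (auto simp: right_diff_distrib dest!: \<mu>)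
  also have "\<dots> = T - (\<Sum>p\<in>E. rate (real (e p)) (\<mu> p))"
    unfolding T_def sum_subtractf[symmetric] by (intro sum.cong) (auto simp: rate_def)
  finally have "real (card ?G) * exp T \<le> ?K * exp (- (\<Sum>p\<in>E. rate (real (e p)) (\<mu> p))) * exp T"
    unfolding weight by (simp add: exp_diff exp_minus field_simps)
  then show ?thesis
    by (simp add: \<mu>_def)
qed

lemma disjoint_family_colouring:
  assumes "disjoint_family_on B Y"
  obtains s where "\<And>k y. y \<in> Y \<Longrightarrow> s k = Some y \<longleftrightarrow> k \<in> B y" "range s \<subseteq> insert None (Some ` Y)"
proof -
  define s where "s k = (if \<exists>y\<in>Y. k \<in> B y then Some (SOME y. y \<in> Y \<and> k \<in> B y) else None)" for k
  have some: "(SOME y. y \<in> Y \<and> k \<in> B y) \<in> Y \<and> k \<in> B (SOME y. y \<in> Y \<and> k \<in> B y)"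
    if "\<exists>y\<in>Y. k \<in> B y" for k
    using that by (intro someI_ex[of "\<lambda>y. y \<in> Y \<and> k \<in> B y"]) blast
  have unique: "y' = y" if "y \<in> Y" "y' \<in> Y" "k \<in> B y" "k \<in> B y'" for k y y'
    using assms that by (auto simp: disjoint_family_on_def)
  show thesis
  proof (rule that[of s])
    show "s k = Some y \<longleftrightarrow> k \<in> B y" if "y \<in> Y" for k y
      using some[of k] unique[OF that] that by (auto simp: s_def)
    show "range s \<subseteq> insert None (Some ` Y)"
      using some by (auto simp: s_def)
  qed
qed

lemma card_permutes_edge_counts_le:
  fixes B :: "'x \<Rightarrow> 'a set" and C :: "'y \<Rightarrow> 'a set"
  assumes A: "finite A" "A \<noteq> {}"
    and B: "disjoint_family_on B X" "\<And>x. x \<in> X \<Longrightarrow> B x \<subseteq> A \<and> B x \<noteq> {}"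
    and C: "finite Y" "disjoint_family_on C Y" "\<And>y. y \<in> Y \<Longrightarrow> C y \<subseteq> A \<and> C y \<noteq> {}"
    and E: "finite E" "E \<subseteq> X \<times> Y"
  shows "real (card {\<sigma>. \<sigma> permutes A \<and> (\<forall>(x, y)\<in>E. card {j\<in>B x. \<sigma> j \<in> C y} = e x y)})
    \<le> fact (card A) * (\<Prod>y\<in>Y. stirling_quot (card (C y))) *
      exp (- (\<Sum>(x, y)\<in>E. rate (real (e x y)) (real (card (B x)) * real (card (C y)) / real (card A))))"
proof -
  obtain r where r: "\<And>k x. x \<in> X \<Longrightarrow> r k = Some x \<longleftrightarrow> k \<in> B x"
    using disjoint_family_colouring[OF B(1)] by metis
  obtain s where s: "\<And>k y. y \<in> Y \<Longrightarrow> s k = Some y \<longleftrightarrow> k \<in> C y" "range s \<subseteq> insert None (Some ` Y)"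
    using disjoint_family_colouring[OF C(2)] by metis
  let ?E = "map_prod Some Some ` E"
  let ?e = "\<lambda>p. e (the (fst p)) (the (snd p))"
  have row: "{j\<in>A. r j = Some x} = B x" if "x \<in> X" for x
    using B(2)[OF that] r[OF that] by auto
  have column: "{k\<in>A. s k = Some y} = C y" if "y \<in> Y" for y
    using C(3)[OF that] s(1)[OF that] by auto
  have pair: "{j\<in>A. (r j, s (\<sigma> j)) = map_prod Some Some p} = {j\<in>B (fst p). \<sigma> j \<in> C (snd p)}"
    if "p \<in> E" for p \<sigma>
    using that E(2) B(2) r s(1) by (cases p) auto
  have edges: "{\<sigma>. \<sigma> permutes A \<and> (\<forall>(x, y)\<in>E. card {j\<in>B x. \<sigma> j \<in> C y} = e x y)} =
      {\<sigma>. \<sigma> permutes A \<and> (\<forall>p\<in>?E. card {j\<in>A. (r j, s (\<sigma> j)) = p} = ?e p)}"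
    using pair by auto
  have "real (card {\<sigma>. \<sigma> permutes A \<and> (\<forall>(x, y)\<in>E. card {j\<in>B x. \<sigma> j \<in> C y} = e x y)}) \<le>
      fact (card A) * (\<Prod>c\<in>insert None (Some ` Y) - {None}. stirling_quot (card {k\<in>A. s k = c})) *
      exp (- (\<Sum>p\<in>?E. rate (real (?e p))
        (real (card {j\<in>A. r j = fst p}) * real (card {k\<in>A. s k = snd p}) / real (card A))))"
    unfolding edges
  proof (rule card_permutes_pair_counts_le[OF A])
    fix p assume "p \<in> ?E"
    then obtain x y where p: "p = (Some x, Some y)" "x \<in> X" "y \<in> Y" using E(2) by auto
    obtain j k where "j \<in> A" "r j = Some x" "k \<in> A" "s k = Some y"
      using row[of x] column[of y] B(2)[of x] C(3)[of y] p by blast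
    then show "fst p \<in> r ` A \<and> snd p \<in> s ` A" using p by force
  qed (use C(1) E(1) s(2) in auto)
  also have "(\<Prod>c\<in>insert None (Some ` Y) - {None}. stirling_quot (card {k\<in>A. s k = c})) =
      (\<Prod>y\<in>Y. stirling_quot (card (C y)))"
    using column by (simp add: prod.reindex)
  also have "(\<Sum>p\<in>?E. rate (real (?e p))
        (real (card {j\<in>A. r j = fst p}) * real (card {k\<in>A. s k = snd p}) / real (card A))) =
      (\<Sum>(x, y)\<in>E. rate (real (e x y)) (real (card (B x)) * real (card (C y)) / real (card A)))"
    using E(2) row column by (subst sum.reindex) (auto simp: inj_on_def intro!: sum.cong)
  finally show ?thesis .
qed

section \<open>Dyadic sums\<close>

lemma sum_power_inj_le:
  fixes q :: real
  assumes "finite K" "inj_on g K" "0 < q" "q < 1"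
  shows "(\<Sum>k\<in>K. q ^ g k) \<le> 1 / (1 - q)"
proof -
  have "(\<Sum>k\<in>K. q ^ g k) = (\<Sum>j\<in>g ` K. q ^ j)"
    using assms(2) by (simp add: sum.reindex)
  also have "\<dots> < 1 / (1 - q)"
    using assms by (intro geometric_sum_less) auto
  finally show ?thesis by simp
qed

lemma sum_dyadic_le:
  fixes c :: real
  assumes "finite K" "0 \<le> M" "\<And>k. k \<in> K \<Longrightarrow> c * 2 ^ k \<le> M"
  shows "(\<Sum>k\<in>K. c * 2 ^ k) \<le> 2 * M"
proof (cases "K = {}")
  case False
  define m where "m = Max K"
  have m: "m \<in> K" "\<And>k. k \<in> K \<Longrightarrow> k \<le> m" using assms(1) False by (auto simp: m_def)
  have "(\<Sum>k\<in>K. c * 2 ^ k) = (\<Sum>k\<in>K. c * 2 ^ m * (1 / 2) ^ (m - k))"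
    using m(2) by (intro sum.cong) (auto simp: power_diff field_simps)
  also have "\<dots> \<le> (\<Sum>k\<in>K. M * (1 / 2) ^ (m - k))"
    using assms(3)[OF m(1)] by (intro sum_mono mult_right_mono) auto
  also have "\<dots> = M * (\<Sum>k\<in>K. (1 / 2) ^ (m - k))"
    by (simp add: sum_distrib_left)
  also have "\<dots> \<le> M * (1 / (1 - 1 / 2))"
  proof (intro mult_left_mono sum_power_inj_le)
    show "inj_on ((-) m) K" by (intro inj_onI) (metis m(2) diff_diff_cancel)
  qed (use assms in auto)
  finally show ?thesis by simp
qed (use assms(2) in simp)

lemma sum_inverse_sqrt_dyadic_le:
  fixes c :: real
  assumes "finite K" "0 < M" "\<And>k. k \<in> K \<Longrightarrow> M \<le> c * 2 ^ k"
  shows "(\<Sum>k\<in>K. sqrt (M / (c * 2 ^ k))) \<le> 4"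
proof (cases "K = {}")
  case False
  define m where "m = Min K"
  have m: "m \<in> K" "\<And>k. k \<in> K \<Longrightarrow> m \<le> k" using assms(1) False by (auto simp: m_def)
  have "4 / 3 \<le> sqrt 2" by (rule real_le_rsqrt) (simp add: power2_eq_square)
  then have r: "1 / sqrt 2 \<le> 3 / (4 :: real)" by (simp add: field_simps)
  have "sqrt (M / (c * 2 ^ k)) \<le> (3 / 4) ^ (k - m)" if "k \<in> K" for k
  proof -
    have "(2::real) ^ k = 2 ^ m * 2 ^ (k - m)" using m(2)[OF that] by (simp flip: power_add)
    then have "M * 2 ^ (k - m) \<le> c * 2 ^ k"
      using mult_right_mono[OF assms(3)[OF m(1)], of "2 ^ (k - m)"] by (simp add: mult_ac)
    moreover have "c * 2 ^ k > 0" using assms(2) assms(3)[OF that] by linarith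
    ultimately have "sqrt (M / (c * 2 ^ k)) \<le> sqrt (1 / 2 ^ (k - m))"
      by (intro real_sqrt_le_mono) (simp add: field_simps)
    also have "\<dots> = (1 / sqrt 2) ^ (k - m)" by (simp add: real_sqrt_power real_sqrt_divide power_divide)
    also have "\<dots> \<le> (3 / 4) ^ (k - m)" using r by (intro power_mono) auto
    finally show ?thesis .
  qed
  then have "(\<Sum>k\<in>K. sqrt (M / (c * 2 ^ k))) \<le> (\<Sum>k\<in>K. (3 / 4) ^ (k - m))"
    by (rule sum_mono)
  also have "\<dots> \<le> 1 / (1 - 3 / 4)"
  proof (rule sum_power_inj_le[OF assms(1)])
    show "inj_on (\<lambda>k. k - m) K" using m(2) by (auto simp: inj_on_def intro: eq_diff_iff[THEN iffD1])
  qed auto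
  finally show ?thesis by simp
qed simp

lemma sum_min_dyadic_le:
  fixes c :: real
  assumes "finite K" "0 < M"
  shows "(\<Sum>k\<in>K. min (c * 2 ^ k) (M * sqrt (M / (c * 2 ^ k)))) \<le> 6 * M"
proof -
  let ?f = "\<lambda>k. min (c * 2 ^ k) (M * sqrt (M / (c * 2 ^ k)))"
  let ?small = "{k\<in>K. c * 2 ^ k \<le> M}" and ?large = "{k\<in>K. \<not> c * 2 ^ k \<le> M}"
  have "(\<Sum>k\<in>K. ?f k) = (\<Sum>k\<in>?small. ?f k) + (\<Sum>k\<in>?large. ?f k)"
    using assms(1) by (subst sum.union_disjoint[symmetric]) (auto intro: sum.cong)
  also have "\<dots> \<le> (\<Sum>k\<in>?small. c * 2 ^ k) + (\<Sum>k\<in>?large. M * sqrt (M / (c * 2 ^ k)))"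
    by (intro add_mono sum_mono) auto
  also have "\<dots> = (\<Sum>k\<in>?small. c * 2 ^ k) + M * (\<Sum>k\<in>?large. sqrt (M / (c * 2 ^ k)))"
    by (simp add: sum_distrib_left)
  also have "\<dots> \<le> 2 * M + M * 4"
    using assms by (intro add_mono mult_left_mono sum_dyadic_le sum_inverse_sqrt_dyadic_le) auto
  finally show ?thesis by simp
qed

lemma sum_dyadic_weights_le:
  fixes a :: "nat \<Rightarrow> real"
  assumes K: "finite K" and w0: "w\<^sub>0 > 0"
    and a: "\<And>k. k \<in> K \<Longrightarrow> 0 < a k \<and> a k \<le> n"
  defines "s \<equiv> \<Sum>k\<in>K. (w\<^sub>0 * 2 ^ k)\<^sup>2 * a k"
  shows "(\<Sum>k\<in>K. w\<^sub>0 * 2 ^ k * (sqrt (a k) * sqrt (sqrt (a k / n)))) \<le> 6 * sqrt s"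
proof (cases "K = {}")
  case False
  let ?c = "w\<^sub>0 * sqrt n" and ?M = "sqrt s"
  have s: "s > 0" unfolding s_def using K False a w0 by (intro sum_pos) auto
  have "w\<^sub>0 * 2 ^ k * (sqrt (a k) * sqrt (sqrt (a k / n))) \<le>
      min (?c * 2 ^ k) (?M * sqrt (?M / (?c * 2 ^ k)))" if k: "k \<in> K" for k
  proof -
    define w where "w = w\<^sub>0 * 2 ^ k"
    have w: "w > 0" using w0 by (simp add: w_def)
    have n: "n > 0" using a[OF k] by linarith
    have "w\<^sup>2 * a k \<le> s"
      unfolding s_def w_def using K k a
      by (intro member_le_sum mult_nonneg_nonneg) (auto intro: less_imp_le)
    then have "sqrt (w\<^sup>2 * a k) \<le> sqrt s" by (rule real_sqrt_le_mono)
    then have root: "w * sqrt (a k) \<le> sqrt s" using w by (simp add: real_sqrt_mult)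
    then have "sqrt (a k / n) \<le> ?M / (w * sqrt n)"
      using w n by (simp add: real_sqrt_divide field_simps)
    then have "(w * sqrt (a k)) * sqrt (sqrt (a k / n)) \<le> ?M * sqrt (?M / (w * sqrt n))"
      using root a[OF k] n s by (intro mult_mono real_sqrt_le_mono) auto
    moreover have "w * (sqrt (a k) * sqrt (sqrt (a k / n))) \<le> w * (sqrt n * 1)"
      using a[OF k] w n by (intro mult_left_mono mult_mono) auto
    ultimately show ?thesis by (simp add: w_def mult_ac)
  qed
  then have "(\<Sum>k\<in>K. w\<^sub>0 * 2 ^ k * (sqrt (a k) * sqrt (sqrt (a k / n)))) \<le>
      (\<Sum>k\<in>K. min (?c * 2 ^ k) (?M * sqrt (?M / (?c * 2 ^ k))))"
    by (rule sum_mono)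
  also have "\<dots> \<le> 6 * ?M"
    using K s by (intro sum_min_dyadic_le) auto
  finally show ?thesis .
qed (simp add: s_def)

section \<open>Greedy removal\<close>

lemma sum_sum_insert_symmetric:
  fixes f :: "'a \<Rightarrow> 'a \<Rightarrow> real"
  assumes "finite R" "x \<notin> R" "\<And>y. f y x = f x y" "f x x = 0"
  shows "(\<Sum>u\<in>insert x R. \<Sum>v\<in>insert x R. f u v) = 2 * (\<Sum>y\<in>R. f x y) + (\<Sum>u\<in>R. \<Sum>v\<in>R. f u v)"
proof -
  have "(\<Sum>u\<in>R. f u x) = (\<Sum>u\<in>R. f x u)" by (intro sum.cong assms(3) refl)
  then show ?thesis using assms(1,2,4) by (simp add: sum.distrib)
qed

lemma greedy_removal:
  fixes f :: "'a \<Rightarrow> 'a \<Rightarrow> real"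
  assumes "finite S\<^sub>0" and symm: "\<And>x y. f x y = f y x" "\<And>x. f x x = 0"
    and loss: "\<And>S x. S \<subseteq> S\<^sub>0 \<Longrightarrow> x \<in> S \<Longrightarrow> \<not> good S x \<Longrightarrow> (\<Sum>y\<in>S. \<bar>f x y\<bar>) \<le> loss x"
  shows "\<exists>S\<subseteq>S\<^sub>0. (\<forall>x\<in>S. good S x) \<and>
    \<bar>\<Sum>x\<in>S\<^sub>0. \<Sum>y\<in>S\<^sub>0. f x y\<bar> \<le> \<bar>\<Sum>x\<in>S. \<Sum>y\<in>S. f x y\<bar> + 2 * (\<Sum>x\<in>S\<^sub>0 - S. loss x)"
  using assms(1) loss
proof (induction S\<^sub>0 rule: finite_psubset_induct)
  case (psubset S\<^sub>0)
  show ?case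
  proof (cases "\<forall>x\<in>S\<^sub>0. good S\<^sub>0 x")
    case True
    then show ?thesis by (intro exI[of _ S\<^sub>0]) simp
  next
    case False
    then obtain x where x: "x \<in> S\<^sub>0" "\<not> good S\<^sub>0 x" by auto
    define R where "R = S\<^sub>0 - {x}"
    have R: "R \<subset> S\<^sub>0" "S\<^sub>0 = insert x R" "x \<notin> R" "finite R"
      using x psubset.hyps by (auto simp: R_def)
    have "\<exists>S\<subseteq>R. (\<forall>x\<in>S. good S x) \<and>
        \<bar>\<Sum>x\<in>R. \<Sum>y\<in>R. f x y\<bar> \<le> \<bar>\<Sum>x\<in>S. \<Sum>y\<in>S. f x y\<bar> + 2 * (\<Sum>x\<in>R - S. loss x)"
      using R(1) psubset.prems by (intro psubset.IH) auto
    then obtain S where S: "S \<subseteq> R" "\<forall>x\<in>S. good S x"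
      "\<bar>\<Sum>x\<in>R. \<Sum>y\<in>R. f x y\<bar> \<le> \<bar>\<Sum>x\<in>S. \<Sum>y\<in>S. f x y\<bar> + 2 * (\<Sum>x\<in>R - S. loss x)"
      by blast
    have "\<bar>\<Sum>y\<in>R. f x y\<bar> \<le> (\<Sum>y\<in>S\<^sub>0. \<bar>f x y\<bar>)"
      unfolding R(2) using R(3,4) symm(2) by simp
    also have "\<dots> \<le> loss x" using x by (intro psubset.prems) auto
    finally have "\<bar>\<Sum>x\<in>S\<^sub>0. \<Sum>y\<in>S\<^sub>0. f x y\<bar> \<le> \<bar>\<Sum>x\<in>R. \<Sum>y\<in>R. f x y\<bar> + 2 * loss x"
      using sum_sum_insert_symmetric[of R x f, OF R(4,3) symm(1) symm(2)] unfolding R(2) by linarith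
    moreover have "S\<^sub>0 - S = insert x (R - S)" using R(2,3) S(1) by auto
    then have "(\<Sum>x\<in>S\<^sub>0 - S. loss x) = loss x + (\<Sum>x\<in>R - S. loss x)"
      using R(3,4) by simp
    ultimately have "\<bar>\<Sum>x\<in>S\<^sub>0. \<Sum>y\<in>S\<^sub>0. f x y\<bar> \<le>
        \<bar>\<Sum>x\<in>S. \<Sum>y\<in>S. f x y\<bar> + 2 * (\<Sum>x\<in>S\<^sub>0 - S. loss x)"
      using S(3) by linarith
    then show ?thesis using S(1,2) R(1) by blast
  qed
qed

section \<open>Patterns in random lifts\<close>

locale random_lift =
  fixes d h n :: nat and adjH :: "nat \<Rightarrow> nat \<Rightarrow> bool"
  assumes regular: "regular_graph d h adjH" and d_pos: "d \<ge> 1" and n_pos: "n \<ge> 1"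
begin

abbreviation adj :: "nat \<times> nat \<Rightarrow> nat \<times> nat \<Rightarrow> bool" where
  "adj \<equiv> Gamma_adj d n h adjH"

abbreviation weight :: "nat \<times> nat \<Rightarrow> real" where
  "weight x \<equiv> wt n h (snd x)"

definition oriented_edges :: "(nat \<times> nat) set" where
  "oriented_edges = {(i, i'). adjH i i' \<and> i < i'}"

lemma adjH_sym: "adjH i i' \<Longrightarrow> adjH i' i"
  using regular unfolding regular_graph_def by blast

lemma adjH_less: "adjH i i' \<Longrightarrow> i < h"
  using regular unfolding regular_graph_def by blast

lemma adjH_neq: "adjH i i' \<Longrightarrow> i \<noteq> i'"
  using regular unfolding regular_graph_def by blast

lemma card_neighbours:
  assumes "i < h"
  shows "card {i'. adjH i' i} = d"
proof -
  have "{i'. adjH i' i} = {i'. adjH i i'}" using adjH_sym by blast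
  also have "card \<dots> = d" using assms regular unfolding regular_graph_def by blast
  finally show ?thesis .
qed

lemma finite_neighbours: "finite {i'. adjH i' i}"
  by (rule finite_subset[of _ "{..<h}"]) (auto intro: adjH_less)

lemma finite_oriented_edges: "finite oriented_edges"
  by (rule finite_subset[of _ "{..<h} \<times> {..<h}"])
    (auto simp: oriented_edges_def intro: adjH_less adjH_sym)

lemma wt_pos: "i < h \<Longrightarrow> wt n h k > 0"
  using n_pos by (simp add: wt_def)

lemma adj_fst: "adj x y \<Longrightarrow> adjH (fst x) (fst y)"
  by (simp add: Gamma_adj_def)

lemma adj_irrefl: "\<not> adj x x"
  using adj_fst adjH_neq by blast

lemma adj_sym:
  assumes "adj x y"
  shows "adj y x"
proof -
  have "adjH (fst x) (fst y)" using assms by (rule adj_fst)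
  then have "adjH (fst y) (fst x)" "weight x > 0" "weight y > 0"
    using adjH_sym adjH_less wt_pos by blast+
  then show ?thesis using assms d_pos by (auto simp: Gamma_adj_def field_simps)
qed

lemma adj_commute: "adj x y \<longleftrightarrow> adj y x"
  using adj_sym by blast

lemma adj_weight_le:
  assumes "adj x y"
  shows "weight y \<le> sqrt d * weight x"
proof -
  have "weight y > 0" using assms adj_fst adj_sym adjH_less wt_pos by blast
  moreover have "weight x / weight y > 1 / sqrt d" using assms by (simp add: Gamma_adj_def)
  ultimately show ?thesis using d_pos by (simp add: field_simps)
qed

lemma potency_eq_double_sum:
  assumes "finite (supp a)"
  shows "potency d n h adjH a e = \<bar>\<Sum>x\<in>supp a. \<Sum>y\<in>supp a. if adj x y
    then weight x * weight y * (real (e x y) - real (a x) * real (a y) / real n) else 0\<bar> / 2"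
proof -
  let ?f = "\<lambda>x y. weight x * weight y * (real (e x y) - real (a x) * real (a y) / real n)"
  have "{(x, y). x \<in> supp a \<and> y \<in> supp a \<and> adj x y} = {p \<in> supp a \<times> supp a. adj (fst p) (snd p)}"
    by auto
  then have "(\<Sum>(x, y)\<in>{(x, y). x \<in> supp a \<and> y \<in> supp a \<and> adj x y}. ?f x y) =
      (\<Sum>p\<in>supp a \<times> supp a. if adj (fst p) (snd p) then ?f (fst p) (snd p) else 0)"
    using assms by (simp only: case_prod_unfold sum.inter_filter finite_cartesian_product)
  also have "\<dots> = (\<Sum>x\<in>supp a. \<Sum>y\<in>supp a. if adj x y then ?f x y else 0)"
    by (simp add: sum.cartesian_product case_prod_unfold)
  finally show ?thesis by (simp add: potency_def abs_mult)
qed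

lemma finite_lift_space: "finite (lift_space n adjH)"
  using finite_oriented_edges unfolding lift_space_def oriented_edges_def[symmetric]
  by (intro finite_PiE finite_permutations) auto

lemma card_lift_space: "card (lift_space n adjH) = fact n ^ card oriented_edges"
  using finite_oriented_edges unfolding lift_space_def oriented_edges_def[symmetric]
  by (simp add: card_PiE card_permutations)

lemma prob_found_eq:
  "prob_found d n h adjH a e =
    real (card {\<sigma>\<in>lift_space n adjH. found_in d n h adjH a e \<sigma>}) / fact n ^ card oriented_edges"
proof -
  have "card (lift_space n adjH) > 0" by (simp add: card_lift_space)
  then have "lift_space n adjH \<noteq> {}" by fastforce
  then show ?thesis
    using finite_lift_space by (simp add: prob_found_def measure_pmf_of_set card_lift_space Int_def)
qed

definition edges_over :: "(nat \<times> nat) set \<Rightarrow> nat \<times> nat \<Rightarrow> ((nat \<times> nat) \<times> nat \<times> nat) set" where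
  "edges_over S p = {(x, y) \<in> S \<times> S. adj x y \<and> (fst x, fst y) = p}"

lemma finite_edges_over: "finite S \<Longrightarrow> finite (edges_over S p)"
  by (rule finite_subset[of _ "S \<times> S"]) (auto simp: edges_over_def)

lemma sum_sum_eq_sum_edges_over:
  fixes f :: "nat \<times> nat \<Rightarrow> nat \<times> nat \<Rightarrow> real"
  assumes S: "finite S" and f: "\<And>x y. f x y = f y x" "\<And>x y. \<not> adj x y \<Longrightarrow> f x y = 0"
  shows "(\<Sum>x\<in>S. \<Sum>y\<in>S. f x y) = 2 * (\<Sum>p\<in>oriented_edges. \<Sum>(x, y)\<in>edges_over S p. f x y)"
proof -
  define up where "up = {(x, y) \<in> S \<times> S. adj x y \<and> fst x < fst y}"
  define down where "down = {(x, y) \<in> S \<times> S. adj x y \<and> fst y < fst x}"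
  have fin: "finite up" "finite down"
    by (rule finite_subset[of _ "S \<times> S"]; use S in \<open>auto simp: up_def down_def\<close>)+
  have "(\<Sum>x\<in>S. \<Sum>y\<in>S. f x y) = (\<Sum>(x, y)\<in>S \<times> S. f x y)"
    by (rule sum.cartesian_product)
  also have "\<dots> = (\<Sum>(x, y)\<in>up \<union> down. f x y)"
  proof (rule sum.mono_neutral_right)
    show "\<forall>p\<in>S \<times> S - (up \<union> down). (case p of (x, y) \<Rightarrow> f x y) = 0"
      using f(2) adj_fst adjH_neq by (fastforce simp: up_def down_def)
  qed (use S in \<open>auto simp: up_def down_def\<close>)
  also have "\<dots> = (\<Sum>(x, y)\<in>up. f x y) + (\<Sum>(x, y)\<in>down. f x y)"
    using fin by (intro sum.union_disjoint) (auto simp: up_def down_def)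
  also have "(\<Sum>(x, y)\<in>down. f x y) = (\<Sum>(x, y)\<in>up. f x y)"
    by (rule sum.reindex_bij_witness[of _ prod.swap prod.swap])
      (auto simp: up_def down_def adj_sym f(1))
  also have "up = (\<Union>p\<in>oriented_edges. edges_over S p)"
    using adj_fst by (auto simp: up_def edges_over_def oriented_edges_def)
  also have "(\<Sum>(x, y)\<in>\<dots>. f x y) = (\<Sum>p\<in>oriented_edges. \<Sum>(x, y)\<in>edges_over S p. f x y)"
    using S finite_oriented_edges
    by (intro sum.UNION_disjoint) (auto simp: finite_edges_over, auto simp: edges_over_def)
  finally show ?thesis by simp
qed

lemma prod_oriented_edges_le:
  fixes z :: "nat \<times> nat \<Rightarrow> real"
  assumes S: "finite S" and z: "\<And>x. x \<in> S \<Longrightarrow> fst x < h \<and> z x \<ge> 1"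
  shows "(\<Prod>p\<in>oriented_edges. \<Prod>y\<in>{y\<in>S. fst y = snd p}. z y) \<le> (\<Prod>y\<in>S. z y ^ d)"
proof -
  have "(\<Prod>p\<in>oriented_edges. \<Prod>y\<in>{y\<in>S. fst y = snd p}. z y) =
      (\<Prod>y\<in>S. \<Prod>p\<in>{p\<in>oriented_edges. fst y = snd p}. z y)"
    using finite_oriented_edges S by (rule prod.swap_restrict)
  also have "\<dots> = (\<Prod>y\<in>S. z y ^ card {p\<in>oriented_edges. fst y = snd p})"
    by simp
  also have "\<dots> \<le> (\<Prod>y\<in>S. z y ^ d)"
  proof (intro prod_mono conjI)
    fix y assume y: "y \<in> S"
    have "card {p\<in>oriented_edges. fst y = snd p} \<le> card {i. adjH i (fst y)}"
      using finite_neighbours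
      by (intro card_inj_on_le[of fst]) (auto simp: inj_on_def oriented_edges_def)
    also have "\<dots> = d" using card_neighbours z[OF y] by blast
    finally show "z y ^ card {p\<in>oriented_edges. fst y = snd p} \<le> z y ^ d"
      using z[OF y] by (intro power_increasing) auto
    show "0 \<le> z y ^ card {p\<in>oriented_edges. fst y = snd p}" using z[OF y] by simp
  qed
  finally show ?thesis .
qed

end

locale lift_pattern = random_lift d h n adjH for d h n adjH +
  fixes a :: "nat \<times> nat \<Rightarrow> nat" and e :: "nat \<times> nat \<Rightarrow> nat \<times> nat \<Rightarrow> nat"
  assumes pattern: "is_pattern d n h adjH a e"
begin

lemma supp_subset_window: "\<exists>k\<^sub>0. supp a \<subseteq> {..<h} \<times> {k\<^sub>0..<k\<^sub>0 + d}"
proof -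
  obtain k\<^sub>0 where window: "\<And>i k. a (i, k) \<noteq> 0 \<Longrightarrow> wt n h k\<^sub>0 \<le> wt n h k \<and> wt n h k \<le> real d * wt n h k\<^sub>0"
    using pattern unfolding is_pattern_def by blast
  have "i < h \<and> k\<^sub>0 \<le> k \<and> k < k\<^sub>0 + d" if "a (i, k) \<noteq> 0" for i k
  proof -
    have i: "i < h" using that pattern unfolding is_pattern_def by (meson not_le)
    define q where "q = sqrt (real n * real h)"
    have wt: "wt n h j = 2 ^ j / q" for j by (simp add: wt_def q_def)
    have "q > 0" using i n_pos by (simp add: q_def)
    then have le: "(2::real) ^ k\<^sub>0 \<le> 2 ^ k" "(2::real) ^ k \<le> real d * 2 ^ k\<^sub>0"
      using window[OF that] by (simp_all add: wt field_simps)
    then have "k\<^sub>0 \<le> k" by simp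
    moreover from this have "(2::real) ^ k = 2 ^ k\<^sub>0 * 2 ^ (k - k\<^sub>0)" by (simp flip: power_add)
    then have "(2::real) ^ (k - k\<^sub>0) \<le> real d" using le(2) by simp
    then have "2 ^ (k - k\<^sub>0) \<le> d" by (metis numeral_power_le_of_nat_cancel_iff)
    then have "k - k\<^sub>0 < d" using less_exp[of "k - k\<^sub>0"] by linarith
    ultimately show ?thesis using i by simp
  qed
  then show ?thesis by (intro exI[of _ k\<^sub>0]) (auto simp: supp_def)
qed

lemma finite_supp: "finite (supp a)"
  using supp_subset_window by (auto intro: finite_subset)

lemma finite_supp_fibre: "finite {k. (i, k) \<in> supp a}"
  using finite_vimageI[OF finite_supp, of "Pair i"] by (simp add: vimage_def inj_on_def)

lemma card_supp_le: "card (supp a) \<le> h * d"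
proof -
  obtain k\<^sub>0 where "supp a \<subseteq> {..<h} \<times> {k\<^sub>0..<k\<^sub>0 + d}" using supp_subset_window by blast
  then have "card (supp a) \<le> card ({..<h} \<times> {k\<^sub>0..<k\<^sub>0 + d})" by (intro card_mono) auto
  then show ?thesis by (simp add: card_cartesian_product)
qed

lemma supp_fst_less: "x \<in> supp a \<Longrightarrow> fst x < h"
  using supp_subset_window by (cases x) auto

lemma supp_size_bounds:
  assumes "x \<in> supp a"
  shows "1 \<le> a x" "a x \<le> n"
proof -
  show "1 \<le> a x" using assms by (simp add: supp_def Suc_le_eq)
  obtain i k where x: "x = (i, k)" by fastforce
  have "a (i, k) \<le> (\<Sum>k\<in>{k. (i, k) \<in> supp a}. a (i, k))"
    using assms x by (intro member_le_sum finite_supp_fibre) auto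
  also have "\<dots> \<le> n"
    using pattern supp_fst_less[OF assms] x unfolding is_pattern_def by auto
  finally show "a x \<le> n" using x by simp
qed

lemma weight_pos: "x \<in> supp a \<Longrightarrow> weight x > 0"
  by (rule wt_pos[OF supp_fst_less])

lemma e_sym: "adj x y \<Longrightarrow> e x y = e y x"
  using pattern unfolding is_pattern_def by blast

lemma finite_if_subset_supp: "S \<subseteq> supp a \<Longrightarrow> finite S"
  using finite_supp by (rule finite_subset[rotated])

definition edge_mean :: "nat \<times> nat \<Rightarrow> nat \<times> nat \<Rightarrow> real" where
  "edge_mean x y = real (a x) * real (a y) / real n"

definition deviation :: "nat \<times> nat \<Rightarrow> nat \<times> nat \<Rightarrow> real" where
  "deviation x y = (if adj x y then weight x * weight y * (real (e x y) - edge_mean x y) else 0)"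

definition edge_rate :: "nat \<times> nat \<Rightarrow> nat \<times> nat \<Rightarrow> real" where
  "edge_rate x y = (if adj x y then rate (real (e x y)) (edge_mean x y) else 0)"

definition rate_dense :: "real \<Rightarrow> (nat \<times> nat) set \<Rightarrow> bool" where
  "rate_dense \<kappa> S \<longleftrightarrow> (\<forall>x\<in>S. \<kappa> * subset_entropy n (a x) \<le> (\<Sum>y\<in>S. edge_rate x y))"

lemma deviation_sym: "deviation x y = deviation y x"
  using adj_commute[of x y] e_sym[of x y] by (simp add: deviation_def edge_mean_def mult_ac)

lemma edge_rate_sym: "edge_rate x y = edge_rate y x"
  using adj_commute[of x y] e_sym[of x y] by (simp add: edge_rate_def edge_mean_def mult_ac)

lemma potency_eq: "potency d n h adjH a e = \<bar>\<Sum>x\<in>supp a. \<Sum>y\<in>supp a. deviation x y\<bar> / 2"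
  unfolding potency_eq_double_sum[OF finite_supp] deviation_def edge_mean_def ..

lemma potency_sub_eq:
  assumes "S \<subseteq> supp a"
  shows "potency d n h adjH (sub_a S a) (sub_e S e) = \<bar>\<Sum>x\<in>S. \<Sum>y\<in>S. deviation x y\<bar> / 2"
proof -
  have supp: "supp (sub_a S a) = S" using assms by (auto simp: supp_def sub_a_def)
  have "finite (supp (sub_a S a))" unfolding supp by (rule finite_if_subset_supp[OF assms])
  then show ?thesis
    unfolding potency_eq_double_sum[OF \<open>finite _\<close>] supp
    by (intro arg_cong[where f = "\<lambda>t. \<bar>t\<bar> / 2"] sum.cong refl)
      (auto simp: deviation_def edge_mean_def sub_a_def sub_e_def)
qed

subsection \<open>Loss of potency\<close>

definition mass :: "nat \<times> nat \<Rightarrow> real" where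
  "mass x = (weight x)\<^sup>2 * real (a x)"

definition fibre_mass :: "nat \<Rightarrow> real" where
  "fibre_mass i = (\<Sum>x\<in>{x\<in>supp a. fst x = i}. mass x)"

definition neighbour_mass :: "nat \<Rightarrow> real" where
  "neighbour_mass i = (\<Sum>y\<in>{y\<in>supp a. adjH i (fst y)}. mass y)"

definition fluctuation :: "nat \<times> nat \<Rightarrow> real" where
  "fluctuation x = sqrt (a x) * sqrt (sqrt (real (a x) / real n))"

definition vertex_loss :: "real \<Rightarrow> nat \<times> nat \<Rightarrow> real" where
  "vertex_loss \<kappa> x = 4 * \<kappa> * sqrt d * mass x +
    sqrt (32 * \<kappa> * neighbour_mass (fst x)) * (weight x * fluctuation x)"

lemma mass_nonneg: "mass x \<ge> 0"
  by (simp add: mass_def)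

lemma fibre_mass_nonneg: "fibre_mass i \<ge> 0"
  unfolding fibre_mass_def by (intro sum_nonneg mass_nonneg)

lemma neighbour_mass_nonneg: "neighbour_mass i \<ge> 0"
  unfolding neighbour_mass_def by (intro sum_nonneg mass_nonneg)

lemma vertex_loss_nonneg: "\<kappa> \<ge> 0 \<Longrightarrow> vertex_loss \<kappa> x \<ge> 0"
  unfolding vertex_loss_def
  by (intro add_nonneg_nonneg mult_nonneg_nonneg)
    (auto simp: mass_nonneg neighbour_mass_nonneg fluctuation_def wt_def)

lemma sum_mass_le: "(\<Sum>x\<in>supp a. mass x) \<le> 10"
  using pattern unfolding is_pattern_def mass_def by blast

lemma sum_supp_by_fibre: "(\<Sum>i<h. \<Sum>x\<in>{x\<in>supp a. fst x = i}. f x) = (\<Sum>x\<in>supp a. f x)"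
  using finite_supp supp_fst_less by (intro sum.group) auto

lemma sum_fibre_mass_le: "(\<Sum>i<h. fibre_mass i) \<le> 10"
  unfolding fibre_mass_def sum_supp_by_fibre by (rule sum_mass_le)

lemma sum_neighbour_mass_le: "(\<Sum>i<h. neighbour_mass i) \<le> 10 * real d"
proof -
  have "(\<Sum>i<h. neighbour_mass i) = (\<Sum>y\<in>supp a. \<Sum>i\<in>{i\<in>{..<h}. adjH i (fst y)}. mass y)"
    unfolding neighbour_mass_def using finite_supp by (intro sum.swap_restrict) auto
  also have "\<dots> = (\<Sum>y\<in>supp a. real d * mass y)"
  proof (intro sum.cong refl)
    fix y assume "y \<in> supp a"
    moreover have "{i\<in>{..<h}. adjH i (fst y)} = {i. adjH i (fst y)}" by (auto intro: adjH_less)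
    ultimately show "(\<Sum>i\<in>{i\<in>{..<h}. adjH i (fst y)}. mass y) = real d * mass y"
      by (simp add: card_neighbours supp_fst_less)
  qed
  also have "\<dots> = real d * (\<Sum>y\<in>supp a. mass y)" by (simp add: sum_distrib_left)
  also have "\<dots> \<le> real d * 10" by (intro mult_left_mono sum_mass_le) simp
  finally show ?thesis by simp
qed

lemma sum_abs_deviation_le_vertex_loss:
  assumes S: "S \<subseteq> supp a" "x \<in> S" and \<kappa>: "\<kappa> \<ge> 0"
    and small: "(\<Sum>y\<in>S. edge_rate x y) \<le> \<kappa> * subset_entropy n (a x)"
  shows "(\<Sum>y\<in>S. \<bar>deviation x y\<bar>) \<le> vertex_loss \<kappa> x"
proof -
  let ?Y = "{y\<in>S. adj x y}"
  let ?dev = "\<lambda>y. weight y * \<bar>real (e x y) - real (a x) * real (a y) / real n\<bar>"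
  have x: "x \<in> supp a" using S by blast
  have S_fin: "finite S" by (rule finite_if_subset_supp[OF S(1)])
  have "(\<Sum>y\<in>?Y. ?dev y) \<le> 4 * \<kappa> * (sqrt d * weight x) * a x +
      sqrt (32 * \<kappa> * neighbour_mass (fst x)) * (sqrt (a x) * sqrt (sqrt (real (a x) / real n)))"
  proof (rule sum_deviation_le_subset_entropy)
    fix y assume "y \<in> ?Y"
    then have "y \<in> supp a" "adj x y" using S(1) by auto
    then show "0 \<le> weight y \<and> weight y \<le> sqrt d * weight x \<and> 0 < real (a y) \<and> 0 \<le> real (e x y)"
      using weight_pos[of y] supp_size_bounds(1)[of y] adj_weight_le by simp
  next
    show "(\<Sum>y\<in>?Y. (weight y)\<^sup>2 * real (a y)) \<le> neighbour_mass (fst x)"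
      unfolding neighbour_mass_def mass_def
      using finite_supp S(1) by (intro sum_mono2) (auto intro: adj_fst)
    show "(\<Sum>y\<in>?Y. rate (real (e x y)) (real (a x) * real (a y) / real n)) \<le> \<kappa> * subset_entropy n (a x)"
      using small unfolding edge_rate_def edge_mean_def sum.inter_filter[OF S_fin] .
  qed (use \<kappa> supp_size_bounds[OF x] weight_pos[OF x] in auto)
  then have "weight x * (\<Sum>y\<in>?Y. ?dev y) \<le> weight x * (4 * \<kappa> * (sqrt d * weight x) * a x +
      sqrt (32 * \<kappa> * neighbour_mass (fst x)) * fluctuation x)"
    using weight_pos[OF x] unfolding fluctuation_def by (intro mult_left_mono) auto
  also have "\<dots> = vertex_loss \<kappa> x"
    by (simp add: vertex_loss_def mass_def power2_eq_square algebra_simps)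
  also have "weight x * (\<Sum>y\<in>?Y. ?dev y) = (\<Sum>y\<in>?Y. \<bar>deviation x y\<bar>)"
    unfolding sum_distrib_left
  proof (rule sum.cong[OF refl])
    fix y assume y: "y \<in> ?Y"
    then have "weight y > 0" using S(1) weight_pos by blast
    then show "weight x * ?dev y = \<bar>deviation x y\<bar>"
      using weight_pos[OF x] y by (simp add: deviation_def edge_mean_def abs_mult)
  qed
  also have "\<dots> = (\<Sum>y\<in>S. \<bar>deviation x y\<bar>)"
    using S_fin by (intro sum.mono_neutral_left) (auto simp: deviation_def)
  finally show ?thesis .
qed

lemma sum_weight_fluctuation_fibre_le:
  "(\<Sum>x\<in>{x\<in>supp a. fst x = i}. weight x * fluctuation x) \<le> 6 * sqrt (fibre_mass i)"
proof (cases "i < h")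
  case True
  define w\<^sub>0 where "w\<^sub>0 = 1 / sqrt (real n * real h)"
  define K where "K = {k. (i, k) \<in> supp a}"
  have wt: "wt n h k = w\<^sub>0 * 2 ^ k" for k by (simp add: wt_def w\<^sub>0_def)
  have reindex: "(\<Sum>x\<in>{x\<in>supp a. fst x = i}. f x) = (\<Sum>k\<in>K. f (i, k))" for f :: "nat \<times> nat \<Rightarrow> real"
    by (rule sum.reindex_bij_witness[of _ "Pair i" snd]) (auto simp: K_def)
  have "(\<Sum>k\<in>K. w\<^sub>0 * 2 ^ k * (sqrt (a (i, k)) * sqrt (sqrt (real (a (i, k)) / real n)))) \<le>
      6 * sqrt (\<Sum>k\<in>K. (w\<^sub>0 * 2 ^ k)\<^sup>2 * real (a (i, k)))"
  proof (rule sum_dyadic_weights_le)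
    show "finite K" unfolding K_def by (rule finite_supp_fibre)
    show "w\<^sub>0 > 0" using True n_pos by (simp add: w\<^sub>0_def)
    show "0 < real (a (i, k)) \<and> real (a (i, k)) \<le> real n" if "k \<in> K" for k
      using that supp_size_bounds[of "(i, k)"] by (simp add: K_def)
  qed
  then show ?thesis
    unfolding fibre_mass_def reindex by (simp add: mass_def fluctuation_def wt)
next
  case False
  then have "{x\<in>supp a. fst x = i} = {}" using supp_fst_less by blast
  then show ?thesis unfolding fibre_mass_def by (simp only: sum.empty) simp
qed

lemma sum_vertex_loss_le:
  assumes \<kappa>: "\<kappa> \<ge> 0"
  shows "(\<Sum>x\<in>supp a. vertex_loss \<kappa> x) \<le> (40 * \<kappa> + 60 * sqrt (32 * \<kappa>)) * sqrt d"
proof -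
  let ?c = "\<lambda>i. sqrt (32 * \<kappa> * neighbour_mass i)"
  have "(\<Sum>x\<in>supp a. ?c (fst x) * (weight x * fluctuation x)) =
      (\<Sum>i<h. \<Sum>x\<in>{x\<in>supp a. fst x = i}. ?c (fst x) * (weight x * fluctuation x))"
    by (rule sum_supp_by_fibre[symmetric])
  also have "\<dots> = (\<Sum>i<h. ?c i * (\<Sum>x\<in>{x\<in>supp a. fst x = i}. weight x * fluctuation x))"
    by (simp add: sum_distrib_left)
  also have "\<dots> \<le> (\<Sum>i<h. ?c i * (6 * sqrt (fibre_mass i)))"
    using \<kappa> neighbour_mass_nonneg by (intro sum_mono mult_left_mono sum_weight_fluctuation_fibre_le) auto
  also have "\<dots> = 6 * sqrt (32 * \<kappa>) * (\<Sum>i<h. sqrt (neighbour_mass i) * sqrt (fibre_mass i))"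
    by (simp add: sum_distrib_left real_sqrt_mult mult_ac)
  also have "\<dots> \<le> 6 * sqrt (32 * \<kappa>) * (sqrt (\<Sum>i<h. neighbour_mass i) * sqrt (\<Sum>i<h. fibre_mass i))"
    using \<kappa> neighbour_mass_nonneg fibre_mass_nonneg by (intro mult_left_mono sum_sqrt_mult_sqrt_le) auto
  also have "\<dots> \<le> 6 * sqrt (32 * \<kappa>) * (sqrt (10 * real d) * sqrt 10)"
    using \<kappa> neighbour_mass_nonneg fibre_mass_nonneg sum_neighbour_mass_le sum_fibre_mass_le
    by (intro mult_left_mono mult_mono real_sqrt_le_mono) (auto intro: sum_nonneg)
  also have "sqrt (10 * real d) * sqrt 10 = 10 * sqrt d"
    by (simp add: real_sqrt_mult)
  finally have "(\<Sum>x\<in>supp a. ?c (fst x) * (weight x * fluctuation x)) \<le> 60 * sqrt (32 * \<kappa>) * sqrt d"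
    by simp
  moreover have "4 * \<kappa> * sqrt d * (\<Sum>x\<in>supp a. mass x) \<le> 4 * \<kappa> * sqrt d * 10"
    using \<kappa> sum_mass_le by (intro mult_left_mono) auto
  ultimately show ?thesis
    by (simp add: vertex_loss_def sum.distrib flip: sum_distrib_left) (simp add: algebra_simps)
qed

lemma potent_rate_dense_subset:
  assumes \<kappa>: "\<kappa> \<ge> 2"
  shows "\<exists>S\<subseteq>supp a. rate_dense \<kappa> S \<and>
    potency d n h adjH a e - 280 * \<kappa> * sqrt d \<le> potency d n h adjH (sub_a S a) (sub_e S e)"
proof -
  let ?W = "\<lambda>S. \<Sum>x\<in>S. \<Sum>y\<in>S. deviation x y"
  have "\<exists>S\<subseteq>supp a. (\<forall>x\<in>S. \<kappa> * subset_entropy n (a x) \<le> (\<Sum>y\<in>S. edge_rate x y)) \<and>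
      \<bar>?W (supp a)\<bar> \<le> \<bar>?W S\<bar> + 2 * (\<Sum>x\<in>supp a - S. vertex_loss \<kappa> x)"
  proof (rule greedy_removal[OF finite_supp deviation_sym])
    show "deviation x x = 0" for x by (simp add: deviation_def adj_irrefl)
    show "(\<Sum>y\<in>S. \<bar>deviation x y\<bar>) \<le> vertex_loss \<kappa> x"
      if "S \<subseteq> supp a" "x \<in> S" "\<not> \<kappa> * subset_entropy n (a x) \<le> (\<Sum>y\<in>S. edge_rate x y)" for S x
      using that \<kappa> by (intro sum_abs_deviation_le_vertex_loss) auto
  qed
  then obtain S where S: "S \<subseteq> supp a" "rate_dense \<kappa> S"
    and W: "\<bar>?W (supp a)\<bar> \<le> \<bar>?W S\<bar> + 2 * (\<Sum>x\<in>supp a - S. vertex_loss \<kappa> x)"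
    unfolding rate_dense_def by blast
  have "(\<Sum>x\<in>supp a - S. vertex_loss \<kappa> x) \<le> (\<Sum>x\<in>supp a. vertex_loss \<kappa> x)"
    using \<kappa> by (intro sum_mono2 finite_supp vertex_loss_nonneg) auto
  also have "\<dots> \<le> (40 * \<kappa> + 60 * sqrt (32 * \<kappa>)) * sqrt d"
    using \<kappa> by (intro sum_vertex_loss_le) auto
  also have "\<dots> \<le> (40 * \<kappa> + 60 * (4 * \<kappa>)) * sqrt d"
    using \<kappa> by (intro mult_right_mono add_left_mono mult_left_mono real_le_lsqrt)
      (auto simp: power2_eq_square)
  finally have "potency d n h adjH a e - 280 * \<kappa> * sqrt d \<le> potency d n h adjH (sub_a S a) (sub_e S e)"
    unfolding potency_eq potency_sub_eq[OF S(1)] using W by simp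
  with S show ?thesis by blast
qed

subsection \<open>Probability of finding a pattern\<close>

definition placements :: "(nat \<times> nat) set \<Rightarrow> (nat \<times> nat \<Rightarrow> nat set) set" where
  "placements S = {A \<in> PiE S (\<lambda>x. {B. B \<subseteq> {0..<n} \<and> card B = a x}).
    \<forall>x\<in>S. \<forall>y\<in>S. fst x = fst y \<longrightarrow> x \<noteq> y \<longrightarrow> A x \<inter> A y = {}}"

definition edge_realizations ::
  "(nat \<times> nat) set \<Rightarrow> (nat \<times> nat \<Rightarrow> nat set) \<Rightarrow> nat \<times> nat \<Rightarrow> (nat \<Rightarrow> nat) set" where
  "edge_realizations S A p =
    {f. f permutes {0..<n} \<and> (\<forall>(x, y)\<in>edges_over S p. card {j\<in>A x. f j \<in> A y} = e x y)}"

definition realizations ::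
  "(nat \<times> nat) set \<Rightarrow> (nat \<times> nat \<Rightarrow> nat set) \<Rightarrow> (nat \<times> nat \<Rightarrow> nat \<Rightarrow> nat) set" where
  "realizations S A = PiE oriented_edges (edge_realizations S A)"

lemma placements_subset: "placements S \<subseteq> PiE S (\<lambda>x. {B. B \<subseteq> {0..<n} \<and> card B = a x})"
  by (auto simp: placements_def)

lemma finite_placements:
  assumes "finite S"
  shows "finite (placements S)"
proof (rule finite_subset[OF placements_subset])
  show "finite (PiE S (\<lambda>x. {B. B \<subseteq> {0..<n} \<and> card B = a x}))"
    using assms by (intro finite_PiE) auto
qed

lemma card_placements_le:
  assumes "finite S"
  shows "card (placements S) \<le> (\<Prod>x\<in>S. n choose a x)"
proof -
  have "card (placements S) \<le> card (PiE S (\<lambda>x. {B. B \<subseteq> {0..<n} \<and> card B = a x}))"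
    using assms by (intro card_mono finite_PiE placements_subset) auto
  also have "\<dots> = (\<Prod>x\<in>S. n choose a x)"
    using assms by (simp add: card_PiE n_subsets)
  finally show ?thesis .
qed

lemma finite_realizations: "finite (realizations S A)"
  unfolding realizations_def
proof (intro finite_PiE finite_oriented_edges)
  show "finite (edge_realizations S A p)" for p
    by (rule finite_subset[OF _ finite_permutations[of "{0..<n}"]]) (auto simp: edge_realizations_def)
qed

lemma found_in_sub_imp_realization:
  assumes \<sigma>: "\<sigma> \<in> lift_space n adjH" and found: "found_in d n h adjH (sub_a S a) (sub_e S e) \<sigma>"
  shows "\<exists>A\<in>placements S. \<sigma> \<in> realizations S A"
proof -
  obtain A where A: "\<And>x. A x \<subseteq> {0..<n} \<and> card (A x) = sub_a S a x"
    and disjoint: "\<And>i k k'. k \<noteq> k' \<Longrightarrow> A (i, k) \<inter> A (i, k') = {}"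
    and count: "\<And>x y. adj x y \<Longrightarrow>
      card {(j, j'). j \<in> A x \<and> j' \<in> A y \<and> lift_adj adjH \<sigma> (fst x, j) (fst y, j')} = sub_e S e x y"
    using found unfolding found_in_def by blast
  have "A x \<inter> A y = {}" if "fst x = fst y" "x \<noteq> y" for x y
    using disjoint that by (metis prod.collapse)
  then have "restrict A S \<in> placements S"
    using A by (simp add: placements_def sub_a_def)
  moreover have "\<sigma> \<in> realizations S (restrict A S)"
    unfolding realizations_def
  proof (rule PiE_I)
    fix p assume p: "p \<in> oriented_edges"
    have "card {j \<in> restrict A S x. \<sigma> p j \<in> restrict A S y} = e x y"
      if "(x, y) \<in> edges_over S p" for x y
    proof -
      have xy: "x \<in> S" "y \<in> S" "adj x y" "p = (fst x, fst y)" "fst x < fst y" "adjH (fst x) (fst y)"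
        using that p by (auto simp: edges_over_def oriented_edges_def)
      have "{(j, j'). j \<in> A x \<and> j' \<in> A y \<and> lift_adj adjH \<sigma> (fst x, j) (fst y, j')}
        = (\<lambda>j. (j, \<sigma> p j)) ` {j \<in> A x. \<sigma> p j \<in> A y}"
        using xy by (auto simp: lift_adj_def)
      then have "card {j \<in> A x. \<sigma> p j \<in> A y} = sub_e S e x y"
        using count[OF xy(3)] by (simp add: card_image inj_on_def)
      then show ?thesis using xy by (simp add: sub_e_def)
    qed
    moreover have "\<sigma> p permutes {0..<n}"
      using \<sigma> p unfolding lift_space_def oriented_edges_def by (auto dest: PiE_mem)
    ultimately show "\<sigma> p \<in> edge_realizations S (restrict A S) p"
      unfolding edge_realizations_def by blast
  next
    fix p assume "p \<notin> oriented_edges"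
    then show "\<sigma> p = undefined"
      using \<sigma> unfolding lift_space_def oriented_edges_def by (rule PiE_arb[rotated])
  qed
  ultimately show ?thesis by blast
qed

lemma card_edge_realizations_le:
  assumes S: "S \<subseteq> supp a" and A: "A \<in> placements S"
  shows "real (card (edge_realizations S A p)) \<le>
    fact n * (\<Prod>y\<in>{y\<in>S. fst y = snd p}. stirling_quot (a y)) *
    exp (- (\<Sum>(x, y)\<in>edges_over S p. edge_rate x y))"
proof -
  have sub: "A x \<subseteq> {0..<n} \<and> card (A x) = a x \<and> A x \<noteq> {}" if "x \<in> S" for x
  proof -
    have "A x \<subseteq> {0..<n} \<and> card (A x) = a x"
      using A that PiE_mem[of A S _ x] by (auto simp: placements_def)
    moreover have "a x \<noteq> 0" using S that supp_size_bounds(1)[of x] by auto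
    ultimately show ?thesis by auto
  qed
  have disjoint: "disjoint_family_on A {x\<in>S. fst x = i}" for i
    using A by (auto simp: placements_def disjoint_family_on_def)
  have "finite S" by (rule finite_if_subset_supp[OF S])
  have "real (card (edge_realizations S A p)) \<le>
      fact (card {0..<n}) * (\<Prod>y\<in>{y\<in>S. fst y = snd p}. stirling_quot (card (A y))) *
      exp (- (\<Sum>(x, y)\<in>edges_over S p.
        rate (real (e x y)) (real (card (A x)) * real (card (A y)) / real (card {0..<n}))))"
    unfolding edge_realizations_def
  proof (rule card_permutes_edge_counts_le)
    show "edges_over S p \<subseteq> {x\<in>S. fst x = fst p} \<times> {y\<in>S. fst y = snd p}"
      by (auto simp: edges_over_def)
  qed (use sub disjoint n_pos finite_edges_over \<open>finite S\<close> in auto)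
  also have "(\<Sum>(x, y)\<in>edges_over S p.
        rate (real (e x y)) (real (card (A x)) * real (card (A y)) / real (card {0..<n}))) =
      (\<Sum>(x, y)\<in>edges_over S p. edge_rate x y)"
    using sub by (intro sum.cong) (auto simp: edges_over_def edge_rate_def edge_mean_def)
  also have "(\<Prod>y\<in>{y\<in>S. fst y = snd p}. stirling_quot (card (A y))) =
      (\<Prod>y\<in>{y\<in>S. fst y = snd p}. stirling_quot (a y))"
    using sub by (intro prod.cong) auto
  finally show ?thesis by simp
qed

lemma card_realizations_le:
  assumes S: "S \<subseteq> supp a" and A: "A \<in> placements S"
  shows "real (card (realizations S A)) \<le> fact n ^ card oriented_edges *
    ((\<Prod>x\<in>S. stirling_quot (a x) ^ d) * exp (- (\<Sum>x\<in>S. \<Sum>y\<in>S. edge_rate x y) / 2))"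
proof -
  let ?z = "\<lambda>p. \<Prod>y\<in>{y\<in>S. fst y = snd p}. stirling_quot (a y)"
  let ?R = "\<lambda>p. \<Sum>(x, y)\<in>edges_over S p. edge_rate x y"
  have "real (card (realizations S A)) = (\<Prod>p\<in>oriented_edges. real (card (edge_realizations S A p)))"
    unfolding realizations_def using finite_oriented_edges by (simp add: card_PiE)
  also have "\<dots> \<le> (\<Prod>p\<in>oriented_edges. fact n * ?z p * exp (- ?R p))"
    by (intro prod_mono conjI card_edge_realizations_le S A) auto
  also have "\<dots> = fact n ^ card oriented_edges * (\<Prod>p\<in>oriented_edges. ?z p) *
      exp (- (\<Sum>p\<in>oriented_edges. ?R p))"
    using finite_oriented_edges by (simp add: prod.distrib exp_sum flip: sum_negf)
  also have "\<dots> \<le> fact n ^ card oriented_edges * (\<Prod>x\<in>S. stirling_quot (a x) ^ d) *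
      exp (- (\<Sum>p\<in>oriented_edges. ?R p))"
    using S supp_fst_less stirling_quot_ge_1
    by (intro mult_right_mono mult_left_mono prod_oriented_edges_le finite_if_subset_supp) auto
  also have "(\<Sum>p\<in>oriented_edges. ?R p) = (\<Sum>x\<in>S. \<Sum>y\<in>S. edge_rate x y) / 2"
    using sum_sum_eq_sum_edges_over[of S edge_rate, OF finite_if_subset_supp[OF S] edge_rate_sym]
    by (simp add: edge_rate_def)
  finally show ?thesis by (simp add: mult_ac)
qed

lemma prob_found_sub_le:
  assumes S: "S \<subseteq> supp a"
  shows "prob_found d n h adjH (sub_a S a) (sub_e S e) \<le> (\<Prod>x\<in>S. real (n choose a x)) *
    ((\<Prod>x\<in>S. stirling_quot (a x) ^ d) * exp (- (\<Sum>x\<in>S. \<Sum>y\<in>S. edge_rate x y) / 2))"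
    (is "_ \<le> _ * ?R")
proof -
  let ?F = "{\<sigma>\<in>lift_space n adjH. found_in d n h adjH (sub_a S a) (sub_e S e) \<sigma>}"
  let ?N = "fact n ^ card oriented_edges :: real"
  have fin: "finite S" by (rule finite_if_subset_supp[OF S])
  have R: "?R \<ge> 0" by (intro mult_nonneg_nonneg prod_nonneg) auto
  have "real (card ?F) \<le> real (card (\<Union>A\<in>placements S. realizations S A))"
    using found_in_sub_imp_realization finite_placements[OF fin] finite_realizations
    by (intro of_nat_mono card_mono) auto
  also have "\<dots> \<le> real (\<Sum>A\<in>placements S. card (realizations S A))"
    by (intro of_nat_mono card_UN_le finite_placements fin)
  also have "\<dots> = (\<Sum>A\<in>placements S. real (card (realizations S A)))"
    by simp
  also have "\<dots> \<le> (\<Sum>A\<in>placements S. ?N * ?R)"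
    by (intro sum_mono card_realizations_le S)
  also have "\<dots> = real (card (placements S)) * ?R * ?N"
    by simp
  also have "\<dots> \<le> real (\<Prod>x\<in>S. n choose a x) * ?R * ?N"
    using card_placements_le[OF fin] R by (intro mult_right_mono of_nat_mono) auto
  finally show ?thesis
    unfolding prob_found_eq by (simp add: divide_le_eq)
qed

lemma prob_found_rate_dense_le:
  assumes S: "S \<subseteq> supp a" "rate_dense (L / 4) S" and L: "L \<ge> 20"
  shows "prob_found d n h adjH (sub_a S a) (sub_e S e) \<le>
    ((2 * exp 1 * real d) ^ d) ^ (h * d) *
    (\<Prod>x\<in>S. real (n choose min (a x) (n div 2))) powr (1 - L / 10)"
proof -
  let ?c = "(2 * exp 1 * real d) ^ d"
  let ?B = "\<lambda>x. real (n choose min (a x) (n div 2))"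
  have fin: "finite S" by (rule finite_if_subset_supp[OF S(1)])
  have "(\<Sum>x\<in>S. L / 4 * subset_entropy n (a x)) \<le> (\<Sum>x\<in>S. \<Sum>y\<in>S. edge_rate x y)"
    using S(2) by (intro sum_mono) (simp add: rate_dense_def)
  moreover have "(\<Sum>x\<in>S. L / 8 * subset_entropy n (a x)) = (\<Sum>x\<in>S. L / 4 * subset_entropy n (a x)) / 2"
    by (simp add: sum_divide_distrib)
  ultimately have "exp (- (\<Sum>x\<in>S. \<Sum>y\<in>S. edge_rate x y) / 2) \<le>
      exp (- (\<Sum>x\<in>S. L / 8 * subset_entropy n (a x)))"
    by simp
  also have "\<dots> = (\<Prod>x\<in>S. exp (- (L / 8 * subset_entropy n (a x))))"
    using fin by (simp add: exp_sum flip: sum_negf)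
  finally have "prob_found d n h adjH (sub_a S a) (sub_e S e) \<le> (\<Prod>x\<in>S. real (n choose a x)) *
      ((\<Prod>x\<in>S. stirling_quot (a x) ^ d) * (\<Prod>x\<in>S. exp (- (L / 8 * subset_entropy n (a x)))))"
    by (intro order_trans[OF prob_found_sub_le[OF S(1)]] mult_left_mono) (auto intro!: prod_nonneg)
  also have "\<dots> = (\<Prod>x\<in>S. real (n choose a x) *
      (stirling_quot (a x) ^ d * exp (- (L / 8 * subset_entropy n (a x)))))"
    by (simp add: prod.distrib)
  also have "\<dots> \<le> (\<Prod>x\<in>S. ?c * ?B x powr (1 - L / 10))"
    using S(1) supp_size_bounds L
    by (intro prod_mono conjI binomial_mult_exp_subset_entropy_le) (auto intro!: mult_nonneg_nonneg)
  also have "\<dots> = ?c ^ card S * (\<Prod>x\<in>S. ?B x) powr (1 - L / 10)"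
    by (simp add: prod.distrib prod_powr_distrib)
  also have "\<dots> \<le> ?c ^ (h * d) * (\<Prod>x\<in>S. ?B x) powr (1 - L / 10)"
  proof (intro mult_right_mono power_increasing)
    show "card S \<le> h * d"
      using card_mono[OF finite_supp S(1)] card_supp_le by linarith
    have "1 * 1 \<le> (2 * exp 1) * real d"
      using d_pos exp_ge_add_one_self[of "1::real"] by (intro mult_mono) auto
    then show "1 \<le> ?c" by (simp add: one_le_power)
  qed simp
  finally show ?thesis .
qed

end

theorem theorem6p2:
  fixes d h :: nat and adjH :: "nat \<Rightarrow> nat \<Rightarrow> bool" and L :: real
  assumes "d \<ge> 2" and "regular_graph d h adjH" and "L \<ge> 20"
  shows "\<exists>C :: real. \<forall>n :: nat. \<forall>a e. n \<ge> 1 \<longrightarrow> is_pattern d n h adjH a e \<longrightarrow>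
     (\<exists>S \<subseteq> {0..<h} \<times> UNIV.
        potency d n h adjH (sub_a S a) (sub_e S e) \<ge> potency d n h adjH a e - 150 * L * sqrt (real d) \<and>
        prob_found d n h adjH (sub_a S a) (sub_e S e) \<le>
          C * (\<Prod>x\<in>{x\<in>S. a x > 0}. real (a x) powr (real d / 4)) *
          (\<Prod>x\<in>{x\<in>S. a x > 0}. real (n choose min (a x) (n div 2))) powr (1 - L / 10))"
proof (rule exI[of _ "((2 * exp 1 * real d) ^ d) ^ (h * d)"], intro allI impI)
  fix n :: nat and a :: "nat \<times> nat \<Rightarrow> nat" and e :: "nat \<times> nat \<Rightarrow> nat \<times> nat \<Rightarrow> nat"
  assume "n \<ge> 1" "is_pattern d n h adjH a e"
  then interpret lift_pattern d h n adjH a e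
    using assms by unfold_locales auto
  let ?C = "((2 * exp 1 * real d) ^ d) ^ (h * d)"
  obtain S where S: "S \<subseteq> supp a" "rate_dense (L / 4) S" and potency:
    "potency d n h adjH a e - 280 * (L / 4) * sqrt d \<le> potency d n h adjH (sub_a S a) (sub_e S e)"
    using potent_rate_dense_subset[of "L / 4"] assms(3) by auto
  let ?B = "\<Prod>x\<in>S. real (n choose min (a x) (n div 2))"
  have "280 * (L / 4) * sqrt d \<le> 150 * L * sqrt d"
    using assms(3) by (intro mult_right_mono) auto
  moreover have "{x\<in>S. a x > 0} = S" "S \<subseteq> {0..<h} \<times> UNIV"
    using S(1) supp_fst_less by (fastforce simp: supp_def)+
  moreover have "1 \<le> (\<Prod>x\<in>S. real (a x) powr (real d / 4))"
    using S(1) supp_size_bounds(1) by (intro prod_ge_1 ge_one_powr_ge_zero) auto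
  then have "?C * 1 * ?B powr (1 - L / 10) \<le>
      ?C * (\<Prod>x\<in>S. real (a x) powr (real d / 4)) * ?B powr (1 - L / 10)"
    by (intro mult_right_mono mult_left_mono) auto
  ultimately show "\<exists>S \<subseteq> {0..<h} \<times> UNIV.
      potency d n h adjH (sub_a S a) (sub_e S e) \<ge> potency d n h adjH a e - 150 * L * sqrt (real d) \<and>
      prob_found d n h adjH (sub_a S a) (sub_e S e) \<le>
        ?C * (\<Prod>x\<in>{x\<in>S. a x > 0}. real (a x) powr (real d / 4)) *
        (\<Prod>x\<in>{x\<in>S. a x > 0}. real (n choose min (a x) (n div 2))) powr (1 - L / 10)"
    using potency prob_found_rate_dense_le[OF S assms(3)] by (intro exI[of _ S]) simp
qed

end
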